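(* Let $n\geq2$, $\mu>0$, $k\in\mathbb{N}$ with $k\geq1$, $\varepsilon>0$, and let $p=p_{\mathrm{Gla}}(n)=\frac{n+1}{n-1}$. If $k=1$, assume further that $\mu\in(0,\mu_1^*(n)]$, where $\mu_1^*(n):=\frac{1}{p-1}=\frac{n-1}{2}$. Assume that $u_0\in W^{1,1}_{\mathrm{loc}}(\mathbb{R}^n)$ and $u_1\in L^1_{\mathrm{loc}}(\mathbb{R}^n)$ are nonnegative, nontrivial (i.e. neither is identically zero), and compactly supported functions with $\operatorname{supp}(u_0,u_1)\subset B_R(0)$ for some $R>0$. Let $u$ be a weak solution on $[0,T_\varepsilon)$ of the Cauchy problem $$u_{tt}-\Delta u+b(t)u_t=|u_t|^p,\qquad u(0,x)=\varepsilon u_0(x),\quad u_t(0,x)=\varepsilon u_1(x),$$ with lifespan $T_\varepsilon$. Then $u$ blows up in finite time and there exists a constant $C>0$, independent of $\varepsilon$, such that: (1) for $k\geq2$, $$\ln T_\varepsilon\left(\ln^{[k]}\left(\mathrm{e}^{[k]}+T_\varepsilon\right)\right)^{-\mu(p-1)}\leq C\,\varepsilon^{-(p-1)};$$ (2) for $k=1$ and $\mu\in(0,\mu_1^*(n)]$, $$\begin{cases}\ln T_\varepsilon\leq C\,\varepsilon^{-\frac{p-1}{1-\mu(p-1)}}&\text{if }\mu\in(0,\frac{n-1}{2}),\\[2pt] \ln\ln T_\varepsilon\leq C\,\varepsilon^{-(p-1)}&\text{if }\mu=\frac{n-1}{2}.\end{cases}$$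
   Context: Notation. $B_R(0)=\{x\in\mathbb{R}^n:|x|\le R\}$. Iterated logarithms and exponentials: $\ln^{[1]}(r)=\ln r$, $\ln^{[j]}(r)=\ln(\ln^{[j-1]}(r))$ for $j\ge2$; $\mathrm{e}^{[1]}=\mathrm{e}$, $\mathrm{e}^{[j]}=\mathrm{e}^{\mathrm{e}^{[j-1]}}$ for $j\ge2$. The damping coefficient is $$b(t)=\frac{\mu}{(\mathrm{e}^{[k]}+t)\prod_{j=1}^k\ln^{[j]}(\mathrm{e}^{[k]}+t)},\qquad t\ge0.$$ Weak solution. A weak solution on $[0,T)$ of $u_{tt}-\Delta u+b(t)u_t=f(u,u_t)$, $u(0,\cdot)=\varepsilon u_0$, $u_t(0,\cdot)=\varepsilon u_1$ (here $f(u,u_t)=|u_t|^p$), with data supported in $B_R(0)$, is a function $u\in\mathscr{C}([0,T),W^{1,1}_{\mathrm{loc}}(\mathbb{R}^n))\cap\mathscr{C}^1([0,T),L^1_{\mathrm{loc}}(\mathbb{R}^n))$ with $f(u,u_t)\in L^1_{\mathrm{loc}}([0,T)\times\mathbb{R}^n)$ such that: (1) $\operatorname{supp}u(t,\cdot)\subset B_{R+t}(0)$ for all $t\in(0,T)$; (2) $u(0,\cdot)=\varepsilon u_0$ in $L^1_{\mathrm{loc}}(\mathbb{R}^n)$; (3) for all $t\in(0,T)$ and all $\psi\in\mathscr{C}_0^\infty([0,T)\times\mathbb{R}^n)$, $$\int_0^t\int_{\mathbb{R}^n}\big(-u_t\psi_s+\nabla u\cdot\nabla\psi+b(s)u_t\psi\big)\,\mathrm{d}x\,\mathrm{d}s+\int_{\mathbb{R}^n}u_t(t,x)\psi(t,x)\,\mathrm{d}x=\varepsilon\int_{\mathbb{R}^n}u_1(x)\psi(0,x)\,\mathrm{d}x+\int_0^t\int_{\mathbb{R}^n}f(u,u_t)\psi\,\mathrm{d}x\,\mathrm{d}s,$$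 where in the double integrals the functions are evaluated at $(s,x)$. The lifespan $T_\varepsilon$ is the maximal existence time of the solution; "$u$ blows up in finite time" means that the lifespan is finite. The bound $\ln\ln T_\varepsilon\le A$ is understood as $T_\varepsilon\le\exp(\exp(A))$ (so it is trivially true if $T_\varepsilon\le1$). *)

theory Defs
  imports "HOL-Analysis.Analysis"
begin

section \<open>Iterated logarithms and the damping coefficient\<close>

text \<open>For $j \ge 1$ these are $\ln^{[j]}$ and $\mathrm{e}^{[j]}$; note
  $\mathrm{e}^{[1]} = \exp 1$ and $\mathrm{e}^{[j]} = \exp(\mathrm{e}^{[j-1]})$.\<close>

definition iter_ln :: "nat \<Rightarrow> real \<Rightarrow> real" where
  "iter_ln j r = (ln ^^ j) r"

definition iter_exp :: "nat \<Rightarrow> real" where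
  "iter_exp j = (exp ^^ j) 1"

definition damping :: "real \<Rightarrow> nat \<Rightarrow> real \<Rightarrow> real" where
  "damping \<mu> k t = \<mu> / ((iter_exp k + t) * (\<Prod>j = 1..k. iter_ln j (iter_exp k + t)))"

definition p_Gla :: "nat \<Rightarrow> real" where
  "p_Gla n = (real n + 1) / (real n - 1)"

definition mu1_star :: "nat \<Rightarrow> real" where
  "mu1_star n = 1 / (p_Gla n - 1)"


section \<open>Smooth test functions\<close>

definition gradient :: "(real ^ 'n \<Rightarrow> real) \<Rightarrow> real ^ 'n \<Rightarrow> real ^ 'n" where
  "gradient f x = (\<chi> i. frechet_derivative f (at x) (axis i 1))"

primrec iter_partial ::
    "'a list \<Rightarrow> ('a::euclidean_space \<Rightarrow> real) \<Rightarrow> 'a \<Rightarrow> real" where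
  "iter_partial [] f = f"
| "iter_partial (e # es) f = (\<lambda>x. frechet_derivative (iter_partial es f) (at x) e)"

text \<open>Differentiability of all iterated partial derivatives makes all of them continuous, so
  this is $\mathscr{C}^\infty$ on the whole space.\<close>

definition smooth :: "('a::euclidean_space \<Rightarrow> real) \<Rightarrow> bool" where
  "smooth f \<longleftrightarrow> (\<forall>es. set es \<subseteq> Basis \<longrightarrow> iter_partial es f differentiable_on UNIV)"

definition test_functions :: "'a::euclidean_space set \<Rightarrow> ('a \<Rightarrow> real) set" where
  "test_functions S =
     {\<phi>. smooth \<phi> \<and> compact (closure {x. \<phi> x \<noteq> 0}) \<and> closure {x. \<phi> x \<noteq> 0} \<subseteq> S}"


section \<open>Local Lebesgue and Sobolev spaces\<close>

text \<open>Elements of these spaces are represented by functions; statements about them hold up to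
  null sets.\<close>

definition L1_loc :: "'a::euclidean_space set \<Rightarrow> ('a \<Rightarrow> 'b::euclidean_space) set" where
  "L1_loc S = {f. \<forall>K. compact K \<longrightarrow> K \<subseteq> S \<longrightarrow> f absolutely_integrable_on K}"

definition weak_gradient :: "(real ^ 'n \<Rightarrow> real) \<Rightarrow> (real ^ 'n \<Rightarrow> real ^ 'n) \<Rightarrow> bool" where
  "weak_gradient f g \<longleftrightarrow> g \<in> L1_loc UNIV \<and>
     (\<forall>\<phi> \<in> test_functions UNIV.
        (LINT x|lebesgue. f x *\<^sub>R gradient \<phi> x) = - (LINT x|lebesgue. \<phi> x *\<^sub>R g x))"

definition W11_loc :: "(real ^ 'n \<Rightarrow> real) set" where
  "W11_loc = {f \<in> L1_loc UNIV. \<exists>g. weak_gradient f g}"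

definition ess_supp :: "('a::euclidean_space \<Rightarrow> real) \<Rightarrow> 'a set" where
  "ess_supp f = - \<Union>{U. open U \<and> (AE x in lebesgue. x \<in> U \<longrightarrow> f x = 0)}"

text \<open>The topology of $L^1_{\mathrm{loc}}$ is given by the seminorms
  $f \mapsto \int_K |f|$ with $K$ compact.\<close>

definition L1_loc_continuous_on ::
    "real set \<Rightarrow> (real \<Rightarrow> 'a::euclidean_space \<Rightarrow> 'b::euclidean_space) \<Rightarrow> bool" where
  "L1_loc_continuous_on I v \<longleftrightarrow>
     (\<forall>t\<in>I. v t \<in> L1_loc UNIV) \<and>
     (\<forall>K. compact K \<longrightarrow> (\<forall>t\<in>I.
        ((\<lambda>s. LINT x:K|lebesgue. norm (v s x - v t x)) \<longlongrightarrow> 0) (at t within I)))"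

definition L1_loc_derivative_on ::
    "real set \<Rightarrow> (real \<Rightarrow> 'a::euclidean_space \<Rightarrow> real) \<Rightarrow> (real \<Rightarrow> 'a \<Rightarrow> real) \<Rightarrow> bool" where
  "L1_loc_derivative_on I u v \<longleftrightarrow>
     (\<forall>K. compact K \<longrightarrow> (\<forall>t\<in>I.
        ((\<lambda>s. LINT x:K|lebesgue. norm ((u s x - u t x) / (s - t) - v t x)) \<longlongrightarrow> 0)
          (at t within I)))"


section \<open>Weak solutions and lifespan\<close>

text \<open>$[0,T)$, where $T = \infty$ is allowed.\<close>

definition time_interval :: "ereal \<Rightarrow> real set" where
  "time_interval T = {t. 0 \<le> t \<and> ereal t < T}"

text \<open>Weak solutions on $[0,T)$ of $u_{tt} - \Delta u + b(t) u_t = |u_t|^p$ with data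
  $\varepsilon u_0$, $\varepsilon u_1$ supported in the closed ball of radius $R$.
  The functions \<open>ut\<close> and \<open>gu\<close> are the derivative $u_t$ of the curve $t \mapsto u(t,\cdot)$ in
  $L^1_{\mathrm{loc}}$ and the weak gradient $\nabla u(t,\cdot)$; both are determined by
  $u$ up to null sets for each time. Elements of $\mathscr{C}_0^\infty([0,T)\times\mathbb{R}^n)$,
  which need not vanish at $t = 0$, are taken as restrictions of elements of
  $\mathscr{C}_0^\infty((-\infty,T)\times\mathbb{R}^n)$.\<close>

definition weak_solution ::
    "(real \<Rightarrow> real) \<Rightarrow> real \<Rightarrow> real \<Rightarrow> (real ^ 'n \<Rightarrow> real) \<Rightarrow> (real ^ 'n \<Rightarrow> real) \<Rightarrow> real \<Rightarrow>
     ereal \<Rightarrow> (real \<Rightarrow> real ^ 'n \<Rightarrow> real) \<Rightarrow> bool" where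
  "weak_solution b p \<epsilon> u0 u1 R T u \<longleftrightarrow> 0 < T \<and>
     (\<exists>ut gu.
        (\<forall>t \<in> time_interval T. weak_gradient (u t) (gu t)) \<and>
        L1_loc_continuous_on (time_interval T) u \<and>
        L1_loc_continuous_on (time_interval T) gu \<and>
        L1_loc_derivative_on (time_interval T) u ut \<and>
        L1_loc_continuous_on (time_interval T) ut \<and>
        (\<lambda>(s, x). \<bar>ut s x\<bar> powr p) \<in> L1_loc (time_interval T \<times> UNIV) \<and>
        (\<forall>t. 0 < t \<and> ereal t < T \<longrightarrow> ess_supp (u t) \<subseteq> cball 0 (R + t)) \<and>
        (AE x in lebesgue. u 0 x = \<epsilon> * u0 x) \<and>
        (\<forall>t. 0 < t \<and> ereal t < T \<longrightarrow>
          (\<forall>\<psi> \<in> test_functions ({s. ereal s < T} \<times> UNIV).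
             (LINT s:{0..t}|lebesgue. LINT x|lebesgue.
                - ut s x * deriv (\<lambda>r. \<psi> (r, x)) s
                + gu s x \<bullet> gradient (\<lambda>y. \<psi> (s, y)) x
                + b s * ut s x * \<psi> (s, x))
             + (LINT x|lebesgue. ut t x * \<psi> (t, x))
             = \<epsilon> * (LINT x|lebesgue. u1 x * \<psi> (0, x))
             + (LINT s:{0..t}|lebesgue. LINT x|lebesgue. \<bar>ut s x\<bar> powr p * \<psi> (s, x)))))"

text \<open>$T$ is the maximal existence time of $u$: no weak solution on a longer time interval
  extends $u$. For $T = \infty$ this just says that $u$ is a global weak solution.\<close>

definition weak_solution_with_lifespan ::
    "(real \<Rightarrow> real) \<Rightarrow> real \<Rightarrow> real \<Rightarrow> (real ^ 'n \<Rightarrow> real) \<Rightarrow> (real ^ 'n \<Rightarrow> real) \<Rightarrow> real \<Rightarrow>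
     ereal \<Rightarrow> (real \<Rightarrow> real ^ 'n \<Rightarrow> real) \<Rightarrow> bool" where
  "weak_solution_with_lifespan b p \<epsilon> u0 u1 R T u \<longleftrightarrow>
     weak_solution b p \<epsilon> u0 u1 R T u \<and>
     \<not> (\<exists>T' v. T < T' \<and> weak_solution b p \<epsilon> u0 u1 R T' v \<and>
          (\<forall>t \<in> time_interval T. AE x in lebesgue. v t x = u t x))"

end

theory Submission
  imports Defs "HOL-Real_Asymp.Real_Asymp"
begin

text \<open>A plane wave $\mathrm{e}^{x_1}$ solves $\Delta \varphi = \varphi$, and its integral over the
  ball of radius $r$ is at most $C \mathrm{e}^r r^{(n-1)/2}$; no spherical average is needed. Testing
  with (cut-offs of) it turns the equation into $U' = V$,
  $V' + b V - U = \int |u_t|^p \varphi \ge \kappa(t) |V|^p$ for the pairings $U$, $V$ of $u$, $u_t$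
  with $\varphi$, where Hoelder's inequality gives
  $\kappa(t) = c\, \mathrm{e}^{-(p-1)t}/(R+t)$ at the Glassey exponent. With $m = \exp \int b$ one has
  $m V \ge \mathrm{e}^t y$ for a function $y$ with $y(0) \sim \varepsilon$ and
  $y' \ge c\, m^{1-p} y^p / (R+t)$, so that
  $\int_0^t m^{1-p}(s)/(R+s)\, \mathrm{d}s \le C \varepsilon^{-(p-1)}$ as long as the solution exists.
  Since $m$ is the $\mu$-th power of $\ln^{[k]}(\mathrm{e}^{[k]}+t)$, this bounds the lifespan.\<close>

subsection \<open>Smooth functions\<close>

text \<open>The power r^((n-1)/2) arises because the mass of exp x_1 on a ball sits where x_1 is
  within O(1) of r, and there the n-1 transverse coordinates have size about sqrt r. Raised to p-1
  in Hoelder's inequality it becomes R+t to the first power exactly at the Glassey exponent, so the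
  decisive integral is a logarithmic borderline: weighted by the power -\<mu>(p-1) of the iterated
  logarithm it diverges for every \<mu> if k \<ge> 2, and for k = 1 precisely if \<mu>(p-1) \<le> 1,
  where equality costs a second logarithm. The obstacle is regularity. |u_t|^p is only integrable in
  space-time, so the equation for V is available only in integrated form. The lower bound
  \<kappa>|V|^p of the source is continuous, however, and yields pointwise inequalities for lower
  right slopes of V; the comparison arguments use these instead of derivatives. The function y comes
  from Duhamel's formula for m U and m V: cosh \<ge> exp / 2 turns the kernel into half an
  exponential, and the term b m U created by multiplying U with m has a favourable sign.\<close>

text \<open>Closed under directional derivatives by construction, hence contained in \<open>smooth\<close>.\<close>

inductive smooth_alg :: "('a::euclidean_space \<Rightarrow> real) \<Rightarrow> bool" where
  const: "smooth_alg (\<lambda>x. c)"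
| linear: "smooth_alg (\<lambda>x. x \<bullet> b)"
| add: "smooth_alg f \<Longrightarrow> smooth_alg g \<Longrightarrow> smooth_alg (\<lambda>x. f x + g x)"
| mult: "smooth_alg f \<Longrightarrow> smooth_alg g \<Longrightarrow> smooth_alg (\<lambda>x. f x * g x)"
| inverse: "smooth_alg f \<Longrightarrow> (\<And>x. f x \<noteq> 0) \<Longrightarrow> smooth_alg (\<lambda>x. inverse (f x))"
| compose: "smooth_alg f \<Longrightarrow> (\<And>n y. (G n has_real_derivative G (Suc n) y) (at y)) \<Longrightarrow>
    smooth_alg (\<lambda>x. G (0::nat) (f x))"

text \<open>The derivative is evaluated in a fixed direction \<open>e\<close> so that it is again a
  scalar function and can stay in the class. Existence and membership go through one induction,
  since both come from the same product or chain rule.\<close>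

lemma smooth_alg_has_derivative:
  assumes "smooth_alg f"
  shows "\<exists>f'. (\<forall>x. (f has_derivative f' x) (at x)) \<and> (\<forall>e. smooth_alg (\<lambda>x. f' x e))"
  using assms
proof induction
  case (const c)
  show ?case by (intro exI[of _ "\<lambda>x e. 0"] conjI allI) (auto intro: smooth_alg.const)
next
  case (linear b)
  show ?case
    by (intro exI[of _ "\<lambda>x e. e \<bullet> b"] conjI allI)
      (auto intro: smooth_alg.const bounded_linear.has_derivative[OF bounded_linear_inner_left])
next
  case (add f g)
  then obtain f' g' where
    "\<And>x. (f has_derivative f' x) (at x)" "\<And>e. smooth_alg (\<lambda>x. f' x e)"
    "\<And>x. (g has_derivative g' x) (at x)" "\<And>e. smooth_alg (\<lambda>x. g' x e)"
    by auto
  then show ?case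
    by (intro exI[of _ "\<lambda>x e. f' x e + g' x e"] conjI allI)
      (auto intro: smooth_alg.add has_derivative_add)
next
  case (mult f g)
  then obtain f' g' where
    "\<And>x. (f has_derivative f' x) (at x)" "\<And>e. smooth_alg (\<lambda>x. f' x e)"
    "\<And>x. (g has_derivative g' x) (at x)" "\<And>e. smooth_alg (\<lambda>x. g' x e)"
    by auto
  then show ?case using mult.hyps
    by (intro exI[of _ "\<lambda>x e. f x * g' x e + f' x e * g x"] conjI allI)
      (auto intro!: smooth_alg.add smooth_alg.mult intro: has_derivative_mult)
next
  case (inverse f)
  then obtain f' where
    f': "\<And>x. (f has_derivative f' x) (at x)" "\<And>e. smooth_alg (\<lambda>x. f' x e)"
    by auto
  have i: "smooth_alg (\<lambda>x. inverse (f x))" using inverse.hyps by (auto intro: smooth_alg.inverse)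
  have "smooth_alg (\<lambda>x. (- 1) * (inverse (f x) * f' x e * inverse (f x)))" for e
    using i f'(2) by (intro smooth_alg.mult smooth_alg.const)
  moreover have "((\<lambda>x. inverse (f x)) has_derivative
      (\<lambda>e. (- 1) * (inverse (f x) * f' x e * inverse (f x)))) (at x)" for x
    using Deriv.has_derivative_inverse[OF inverse.hyps(2) f'(1)] by simp
  ultimately show ?case
    by (intro exI[of _ "\<lambda>x e. (- 1) * (inverse (f x) * f' x e * inverse (f x))"]) blast
next
  case (compose f G)
  then obtain f' where
    f': "\<And>x. (f has_derivative f' x) (at x)" "\<And>e. smooth_alg (\<lambda>x. f' x e)"
    by auto
  \<comment> \<open>The shifted sequence of derivatives satisfies the premise of
    \<open>compose\<close> again; this is why that rule carries a whole sequence instead of one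
    function.\<close>
  have i: "smooth_alg (\<lambda>x. G (Suc 0) (f x))"
    using smooth_alg.compose[of f "\<lambda>n. G (Suc n)"] compose.hyps by auto
  have "smooth_alg (\<lambda>x. G (Suc 0) (f x) * f' x e)" for e
    using i f'(2) by (intro smooth_alg.mult)
  moreover have "((\<lambda>x. G 0 (f x)) has_derivative (\<lambda>e. G (Suc 0) (f x) * f' x e)) (at x)" for x
    using has_derivative_compose[OF f'(1) compose.hyps(2)[of 0, unfolded has_field_derivative_def]]
    by simp
  ultimately show ?case
    by (intro exI[of _ "\<lambda>x e. G (Suc 0) (f x) * f' x e"]) blast
qed

lemma smooth_alg_partial:
  assumes "smooth_alg f"
  shows "smooth_alg (\<lambda>x. frechet_derivative f (at x) e)"
    and "f differentiable_on UNIV"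
proof -
  obtain f' where f': "\<And>x. (f has_derivative f' x) (at x)" "\<And>e. smooth_alg (\<lambda>x. f' x e)"
    using smooth_alg_has_derivative[OF assms] by auto
  have "frechet_derivative f (at x) = f' x" for x
    using f'(1) frechet_derivative_at by metis
  then show "smooth_alg (\<lambda>x. frechet_derivative f (at x) e)" using f'(2) by simp
  show "f differentiable_on UNIV"
    using f'(1) by (auto simp: differentiable_on_def differentiable_def)
qed

lemma smooth_alg_iter_partial: "smooth_alg f \<Longrightarrow> smooth_alg (iter_partial es f)"
  by (induction es) (auto intro: smooth_alg_partial)

text \<open>Test functions are built inside \<open>smooth_alg\<close>, so no closure properties of
  \<open>smooth\<close> itself have to be shown.\<close>

lemma smooth_if_smooth_alg: "smooth_alg f \<Longrightarrow> smooth f"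
  unfolding smooth_def using smooth_alg_partial(2) smooth_alg_iter_partial by blast

lemma smooth_alg_prod:
  assumes "finite B" "\<And>b. b \<in> B \<Longrightarrow> smooth_alg (f b)"
  shows "smooth_alg (\<lambda>x. \<Prod>b\<in>B. f b x)"
  using assms by (induction B rule: finite_induct) (auto intro: smooth_alg.const smooth_alg.mult)

lemma smooth_alg_affine: "smooth_alg (\<lambda>x. c + d * (x \<bullet> b))"
  by (intro smooth_alg.add smooth_alg.mult smooth_alg.const smooth_alg.linear)

lemma smooth_alg_exp: "smooth_alg f \<Longrightarrow> smooth_alg (\<lambda>x. exp (f x))"
  using smooth_alg.compose[of f "\<lambda>_. exp"] by (auto intro: derivative_eq_intros)

subsection \<open>Cutoff functions\<close>

text \<open>The classical smooth function with all derivatives zero at the origin; all cutoffs are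
  made from it.\<close>

definition flat :: "real \<Rightarrow> real" where
  "flat x = (if x > 0 then exp (- (1 / x)) else 0)"

text \<open>The polynomial factor appearing in the $n$-th derivative of \<open>flat\<close>, as a function of
  $1/x$.\<close>

primrec flat_poly :: "nat \<Rightarrow> real poly" where
  "flat_poly 0 = 1"
| "flat_poly (Suc n) = [:0, 0, 1:] * (flat_poly n - pderiv (flat_poly n))"

definition flat_deriv :: "nat \<Rightarrow> real \<Rightarrow> real" where
  "flat_deriv n x = (if x > 0 then poly (flat_poly n) (1 / x) * exp (- (1 / x)) else 0)"

lemma poly_exp_tendsto_0:
  fixes P :: "real poly"
  shows "((\<lambda>y. poly P y * exp (- y)) \<longlongrightarrow> 0) at_top"
proof -
  have "((\<lambda>y. \<Sum>i\<le>degree P. coeff P i * (y ^ i / exp y)) \<longlongrightarrow> (\<Sum>i\<le>degree P. coeff P i * 0)) at_top"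
    by (intro tendsto_sum tendsto_mult tendsto_const tendsto_power_div_exp_0)
  then show ?thesis
    by (simp add: poly_altdef sum_distrib_right exp_minus divide_inverse mult.assoc)
qed

lemma flat_deriv_has_derivative:
  "(flat_deriv n has_real_derivative flat_deriv (Suc n) x) (at x)"
proof -
  consider "x > 0" | "x < 0" | "x = 0" by linarith
  then show ?thesis
  proof cases
    case 1
    \<comment> \<open>With z = 1/x one has d/dx = - z^2 d/dz, which maps P(z) exp(-z) to z^2 (P -
      P')(z) exp(-z); this is the recursion of \<open>flat_poly\<close>.\<close>
    have d: "((\<lambda>x. poly (flat_poly n) (1 / x) * exp (- (1 / x))) has_real_derivative
        flat_deriv (Suc n) x) (at x)"
      using 1 by (auto intro!: derivative_eq_intros poly_DERIV[THEN DERIV_chain2]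
          simp: flat_deriv_def field_simps power2_eq_square)
    have ev: "eventually (\<lambda>y. poly (flat_poly n) (1 / y) * exp (- (1 / y)) = flat_deriv n y) (nhds x)"
      using eventually_nhds_in_open[of "{0<..}" x] 1
      by (auto elim!: eventually_mono simp: flat_deriv_def)
    show ?thesis using DERIV_cong_ev[OF refl ev refl] d by simp
  next
    case 2
    have ev: "eventually (\<lambda>y. 0 = flat_deriv n y) (nhds x)"
      using eventually_nhds_in_open[of "{..<0}" x] 2
      by (auto elim!: eventually_mono simp: flat_deriv_def)
    have d: "((\<lambda>x. 0) has_real_derivative flat_deriv (Suc n) x) (at x)"
      using 2 by (simp add: flat_deriv_def)
    show ?thesis using DERIV_cong_ev[OF refl ev refl] d by simp
  next
    case 3
    \<comment> \<open>From the right, the difference quotient at 0 is z P(z) exp(-z) with z = 1/y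
      tending to infinity, where the exponential wins.\<close>
    have "((\<lambda>y. flat_deriv n y / y) \<longlongrightarrow> 0) (at_right 0)"
    proof -
      have "((\<lambda>y. poly ([:0, 1:] * flat_poly n) (1 / y) * exp (- (1 / y))) \<longlongrightarrow> 0) (at_right (0::real))"
        using filterlim_compose[OF poly_exp_tendsto_0[of "[:0, 1:] * flat_poly n"]
            filterlim_inverse_at_top_right]
        by (simp add: divide_inverse)
      moreover have "eventually (\<lambda>y. poly ([:0, 1:] * flat_poly n) (1 / y) * exp (- (1 / y)) =
          flat_deriv n y / y) (at_right (0::real))"
        by (rule eventually_mono[OF eventually_at_right_less]) (simp add: flat_deriv_def)
      ultimately show ?thesis by (rule Lim_transform_eventually)
    qed
    moreover have "((\<lambda>y. flat_deriv n y / y) \<longlongrightarrow> 0) (at_left 0)"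
      by (rule Lim_transform_eventually[of "\<lambda>_. 0"])
        (auto simp: eventually_at_left_field flat_deriv_def intro!: exI[of _ "-1"])
    ultimately have "((\<lambda>y. flat_deriv n y / y) \<longlongrightarrow> 0) (at 0)"
      using filterlim_split_at by blast
    then show ?thesis
      using 3 by (simp add: has_field_derivative_iff flat_deriv_def)
  qed
qed

lemma smooth_alg_flat: "smooth_alg f \<Longrightarrow> smooth_alg (\<lambda>x. flat (f x))"
proof -
  have "flat = flat_deriv 0" by (auto simp: flat_def flat_deriv_def)
  then show "smooth_alg f \<Longrightarrow> smooth_alg (\<lambda>x. flat (f x))"
    using smooth_alg.compose[of f flat_deriv] flat_deriv_has_derivative by auto
qed

definition step :: "real \<Rightarrow> real" where
  "step y = flat y / (flat y + flat (1 - y))"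

text \<open>At least one of y and 1 - y is positive, so the denominator of \<open>step\<close> never
  vanishes.\<close>

lemma flat_sum_pos: "flat y + flat (1 - y) > 0"
  by (auto simp: flat_def intro: add_pos_pos add_nonneg_pos)

lemma step_eq_0: "y \<le> 0 \<Longrightarrow> step y = 0"
  by (simp add: step_def flat_def)

lemma step_eq_1: "y \<ge> 1 \<Longrightarrow> step y = 1"
  by (simp add: step_def flat_def)

lemma smooth_alg_step: 
  assumes "smooth_alg f" shows "smooth_alg (\<lambda>x. step (f x))"
proof -
  have nz: "flat (f x) + flat (1 + (- 1) * f x) \<noteq> 0" for x
    using flat_sum_pos[of "f x"] by simp
  have "smooth_alg (\<lambda>x. 1 + (- 1) * f x)"
    by (intro smooth_alg.add smooth_alg.mult smooth_alg.const assms)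
  then have "smooth_alg (\<lambda>x. flat (f x) * inverse (flat (f x) + flat (1 + (- 1) * f x)))"
    using nz by (intro smooth_alg.mult smooth_alg.inverse smooth_alg.add smooth_alg_flat
        smooth_alg.const assms)
  then show ?thesis by (simp add: step_def divide_inverse)
qed

text \<open>A product over coordinates, so that only affine functions enter and the norm, which is
  not smooth at 0, is avoided. It is 1 on the cube of half side A and 0 outside the one of half side
  A + 1.\<close>

definition cutoff :: "real \<Rightarrow> 'a::euclidean_space \<Rightarrow> real" where
  "cutoff A x = (\<Prod>b\<in>Basis. step (A + 1 - x \<bullet> b) * step (A + 1 + x \<bullet> b))"

lemma cutoff_eq_1: "norm x \<le> A \<Longrightarrow> cutoff A x = 1"
proof -
  assume a: "norm x \<le> A"
  have "step (A + 1 - x \<bullet> b) * step (A + 1 + x \<bullet> b) = 1" if "b \<in> Basis" for b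
    using Basis_le_norm[OF that, of x] a by (simp add: step_eq_1 abs_le_iff)
  then show ?thesis by (simp add: cutoff_def)
qed

lemma cutoff_support: "cutoff A x \<noteq> 0 \<Longrightarrow> x \<in> cbox (\<Sum>b\<in>Basis. - (A + 1) *\<^sub>R b) (\<Sum>b\<in>Basis. (A + 1) *\<^sub>R b)"
proof -
  assume "cutoff A x \<noteq> 0"
  then have *: "step (A + 1 - x \<bullet> b) \<noteq> 0 \<and> step (A + 1 + x \<bullet> b) \<noteq> 0" if "b \<in> Basis" for b
    using that by (auto simp: cutoff_def)
  have "- (A + 1) \<le> x \<bullet> b \<and> x \<bullet> b \<le> A + 1" if "b \<in> Basis" for b
    using *[OF that] step_eq_0[of "A + 1 - x \<bullet> b"] step_eq_0[of "A + 1 + x \<bullet> b"] by linarith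
  then show ?thesis by (simp add: mem_box)
qed

lemma smooth_alg_cutoff: "smooth_alg (\<lambda>x. cutoff A (x::'a::euclidean_space))"
proof -
  have "smooth_alg (\<lambda>x. \<Prod>b\<in>Basis. step ((A + 1) + (- 1) * (x \<bullet> b)) * step ((A + 1) + 1 * (x \<bullet> (b::'a))))"
    by (intro smooth_alg_prod smooth_alg.mult smooth_alg_step smooth_alg_affine finite_Basis)
  then show ?thesis by (simp add: cutoff_def)
qed

text \<open>Serves to pull back functions of time and of space along \<open>fst\<close> and
  \<open>snd\<close>. Composing an inner product with \<open>L\<close> moves \<open>L\<close> to the
  other side as its adjoint.\<close>

lemma smooth_alg_compose_linear:
  fixes L :: "'a::euclidean_space \<Rightarrow> 'b::euclidean_space"
  assumes "smooth_alg f" "linear L"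
  shows "smooth_alg (\<lambda>z. f (L z))"
  using assms(1)
proof induction
  case (linear b)
  have "(\<lambda>z. L z \<bullet> b) = (\<lambda>z. z \<bullet> adjoint L b)"
    using adjoint_works[OF assms(2)] by auto
  then show ?case using smooth_alg.linear by metis
next
  case (compose f G)
  show ?case by (rule smooth_alg.compose[of "\<lambda>z. f (L z)" G, OF compose.IH compose.hyps(2)])
qed (auto intro: smooth_alg.const smooth_alg.add smooth_alg.mult smooth_alg.inverse)

lemma smooth_alg_continuous: "smooth_alg f \<Longrightarrow> continuous_on UNIV f"
  using smooth_alg_partial(2) differentiable_imp_continuous_on by blast

lemma frechet_derivative_cong_open:
  assumes "smooth_alg g" "open S" "x \<in> S" "\<And>y. y \<in> S \<Longrightarrow> f y = g y"
  shows "frechet_derivative f (at x) = frechet_derivative g (at x)"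
proof -
  obtain g' where g': "(g has_derivative g') (at x)"
    using smooth_alg_has_derivative[OF assms(1)] by blast
  have "(f has_derivative g') (at x)"
    using has_derivative_transform_within_open[OF g' assms(2,3)] assms(4) by simp
  then show ?thesis using g' frechet_derivative_at by metis
qed

lemma test_functionsI:
  assumes "smooth_alg f" "compact K" "K \<subseteq> S" "\<And>x. f x \<noteq> 0 \<Longrightarrow> x \<in> K"
  shows "f \<in> test_functions S"
proof -
  have "closure {x. f x \<noteq> 0} \<subseteq> K"
    using assms(2,4) by (intro closure_minimal compact_imp_closed) auto
  moreover have "compact (closure {x. f x \<noteq> 0})"
    using calculation closed_Int_compact[OF closed_closure assms(2)] by (metis inf.absorb1)
  ultimately show ?thesis
    using assms(1,3) smooth_if_smooth_alg by (auto simp: test_functions_def)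
qed

lemma frechet_derivative_eq_0:
  fixes f :: "'a::euclidean_space \<Rightarrow> real"
  assumes "closed K" "\<And>x. f x \<noteq> 0 \<Longrightarrow> x \<in> K" "x \<notin> K"
  shows "frechet_derivative f (at x) e = 0"
proof -
  have "frechet_derivative f (at x) = frechet_derivative (\<lambda>_. 0) (at x)"
    using assms by (intro frechet_derivative_cong_open[of _ "- K"] smooth_alg.const) auto
  then show ?thesis by simp
qed

section \<open>Cut-off plane waves as space-time test functions\<close>

definition plane_wave :: "'n::finite \<Rightarrow> real ^ 'n \<Rightarrow> real" where
  "plane_wave i x = exp (x \<bullet> axis i 1)"

definition cut_wave :: "real \<Rightarrow> 'n::finite \<Rightarrow> real ^ 'n \<Rightarrow> real" where
  "cut_wave A i x = cutoff A x * plane_wave i x"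

lemma smooth_alg_plane_wave: "smooth_alg (\<lambda>x. plane_wave i x)"
  unfolding plane_wave_def by (intro smooth_alg_exp smooth_alg.linear)

lemma smooth_alg_cut_wave: "smooth_alg (\<lambda>x. cut_wave A i x)"
  unfolding cut_wave_def by (intro smooth_alg.mult smooth_alg_cutoff smooth_alg_plane_wave)

lemma plane_wave_partial:
  "frechet_derivative (plane_wave i) (at x) (axis j 1) = (if j = i then plane_wave i x else 0)"
proof -
  have "(plane_wave i has_derivative (\<lambda>h. plane_wave i x * (h \<bullet> axis i 1))) (at x)"
    unfolding plane_wave_def[abs_def] by (auto intro!: derivative_eq_intros)
  then show ?thesis
    by (simp add: inner_axis_axis flip: frechet_derivative_at)
qed

text \<open>On the open ball the cutoff is identically 1, so derivatives see only the wave. Summed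
  over j this is \<Delta>\<phi> = \<phi> there; openness is why the bound on the norm is
  strict.\<close>

lemma cut_wave_second_partial:
  assumes "norm x < A"
  shows "iter_partial [axis j 1, axis j 1] (cut_wave A i) x = (if j = i then plane_wave i x else 0)"
proof -
  have 1: "frechet_derivative (cut_wave A i) (at y) (axis j 1) = (if j = i then plane_wave i y else 0)"
    if "y \<in> ball 0 A" for y
  proof -
    have "frechet_derivative (cut_wave A i) (at y) = frechet_derivative (plane_wave i) (at y)"
      using that by (intro frechet_derivative_cong_open[of _ "ball 0 A"] smooth_alg_plane_wave)
        (auto simp: cut_wave_def cutoff_eq_1)
    then show ?thesis by (simp add: plane_wave_partial)
  qed
  have "smooth_alg (\<lambda>y. if j = i then plane_wave i y else 0)"
    by (cases "j = i") (auto simp: smooth_alg_plane_wave intro: smooth_alg.const)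
  then have "frechet_derivative (\<lambda>y. frechet_derivative (cut_wave A i) (at y) (axis j 1)) (at x)
      = frechet_derivative (\<lambda>y. if j = i then plane_wave i y else 0) (at x)"
    by (rule frechet_derivative_cong_open[OF _ open_ball[of 0 A]]) (use assms 1 in auto)
  then show ?thesis using plane_wave_partial[of i x j] by (cases "j = i") simp_all
qed

text \<open>Equal to 1 on [-1, t1] and supported in [-2, t2]. The second factor makes the support
  compact in the past, and reaching below 0 makes the two-sided time derivative vanish at time 0 as
  well.\<close>

definition time_cutoff :: "real \<Rightarrow> real \<Rightarrow> real \<Rightarrow> real" where
  "time_cutoff t1 t2 s = step ((t2 - s) / (t2 - t1)) * step (s + 2)"

lemma time_cutoff_eq_1: "t1 < t2 \<Longrightarrow> s \<in> {- 1..t1} \<Longrightarrow> time_cutoff t1 t2 s = 1"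
  by (simp add: time_cutoff_def step_eq_1)

lemma time_cutoff_support:
  assumes "t1 < t2" "time_cutoff t1 t2 s \<noteq> 0" shows "s \<in> {- 2..t2}"
proof -
  have "\<not> (t2 - s) / (t2 - t1) \<le> 0" "\<not> s + 2 \<le> 0"
    using assms step_eq_0 by (auto simp: time_cutoff_def)
  then show ?thesis using assms by (auto simp: divide_le_0_iff not_le)
qed

lemma smooth_alg_time_cutoff: "smooth_alg (\<lambda>s. time_cutoff t1 t2 s)"
proof -
  have "smooth_alg (\<lambda>s::real. step (t2 / (t2 - t1) + (- (1 / (t2 - t1))) * (s \<bullet> 1)) * step (2 + 1 * (s \<bullet> 1)))"
    by (intro smooth_alg.mult smooth_alg_step smooth_alg_affine)
  then show ?thesis by (simp add: time_cutoff_def[abs_def] diff_divide_distrib add.commute inner_real_def)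
qed

lemma space_time_test_function:
  fixes i :: "'n::finite"
  assumes "t1 < t2" "ereal t2 < T"
  shows "(\<lambda>z. time_cutoff t1 t2 (fst z) * cut_wave A i (snd z))
    \<in> test_functions ({s. ereal s < T} \<times> UNIV)"
proof (rule test_functionsI)
  define K where "K = cbox (\<Sum>b\<in>Basis. - (A + 1) *\<^sub>R b) (\<Sum>b\<in>Basis. (A + 1) *\<^sub>R b :: real ^ 'n)"
  show "smooth_alg (\<lambda>z. time_cutoff t1 t2 (fst z) * cut_wave A i (snd z))"
    by (intro smooth_alg.mult smooth_alg_compose_linear[OF smooth_alg_time_cutoff linear_fst]
        smooth_alg_compose_linear[OF smooth_alg_cut_wave linear_snd])
  show "compact ({- 2..t2} \<times> K)" by (auto simp: K_def intro: compact_Times)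
  have "ereal s < T" if "s \<le> t2" for s
    using that assms(2) by (metis ereal_less_eq(3) le_less_trans)
  then show "{- 2..t2} \<times> K \<subseteq> {s. ereal s < T} \<times> UNIV" by auto
  show "z \<in> {- 2..t2} \<times> K" if "time_cutoff t1 t2 (fst z) * cut_wave A i (snd z) \<noteq> 0" for z
    using that time_cutoff_support[OF assms(1), of "fst z"] cutoff_support[of A "snd z"]
    by (cases z) (auto simp: cut_wave_def K_def)
qed

subsection \<open>Lower right slopes\<close>

text \<open>The lower right Dini derivative of f at t is at least c, written without a lower
  limit.\<close>

definition lower_slope :: "(real \<Rightarrow> real) \<Rightarrow> real \<Rightarrow> real \<Rightarrow> bool" where
  "lower_slope f t c \<longleftrightarrow> (\<forall>\<eta>>0. eventually (\<lambda>s. f s - f t \<ge> (c - \<eta>) * (s - t)) (at_right t))"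

text \<open>The tilted function \<open>g\<close> absorbs the error \<eta> in the slope. If the last
  point where \<open>g\<close> is at least \<open>g a\<close> lay before b, the slope condition
  there would give later points of the same kind.\<close>

lemma lower_slope_nonneg_imp_le:
  assumes "a \<le> b" "continuous_on {a..b} f" "\<And>t. t \<in> {a..<b} \<Longrightarrow> lower_slope f t 0"
  shows "f a \<le> f b"
proof (rule field_le_epsilon)
  fix e :: real assume e: "e > 0"
  \<comment> \<open>The summand 1 covers the case a = b.\<close>
  define \<eta> where "\<eta> = e / (b - a + 1)"
  have \<eta>: "\<eta> > 0" "\<eta> * (b - a) \<le> e" using e assms(1) by (auto simp: \<eta>_def field_simps)
  define g where "g = (\<lambda>s. f s + \<eta> * (s - a))"
  define Z where "Z = {s \<in> {a..b}. g a \<le> g s}"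
  have cg: "continuous_on {a..b} g" unfolding g_def using assms(2) by (intro continuous_intros)
  have "closed Z" unfolding Z_def
    by (intro continuous_closed_preimage_constant continuous_on_closed_Collect_le cg) auto
  moreover have Z: "a \<in> Z" "bdd_above Z" using assms(1) by (auto simp: Z_def)
  ultimately have cZ: "Sup Z \<in> Z" using closed_contains_Sup[of Z] by blast
  define c where "c = Sup Z"
  have "c = b"
  proof (rule ccontr)
    assume "c \<noteq> b"
    then have c: "c \<in> {a..<b}" using cZ by (auto simp: c_def Z_def)
    have "eventually (\<lambda>s. f s - f c \<ge> (0 - \<eta>) * (s - c)) (at_right c)"
      using assms(3)[OF c] \<eta> by (auto simp: lower_slope_def)
    moreover have "eventually (\<lambda>s. s \<in> {c<..<b}) (at_right c)"
      using c eventually_at_right_real[of c b] by simp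
    ultimately have "eventually (\<lambda>s. s \<in> Z \<and> s > c) (at_right c)"
    proof eventually_elim
      case (elim s)
      have "g s \<ge> g c" using elim by (simp add: g_def algebra_simps)
      moreover have "g c \<ge> g a" using cZ by (simp add: c_def Z_def)
      ultimately show ?case using elim c by (auto simp: Z_def)
    qed
    then obtain s where "s \<in> Z" "s > c"
      using eventually_happens[of _ "at_right c"] trivial_limit_at_right_real by blast
    then show False using cSup_upper[OF _ Z(2)] by (force simp: c_def)
  qed
  then show "f a \<le> f b + e" using cZ \<eta> by (auto simp: c_def Z_def g_def)
qed

lemma lower_slope_eventually_mono:
  assumes "lower_slope g t c" "eventually (\<lambda>s. f s - f t \<ge> g s - g t) (at_right t)"
  shows "lower_slope f t c"
  unfolding lower_slope_def
proof (intro allI impI)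
  fix \<eta> :: real assume "\<eta> > 0"
  then have "eventually (\<lambda>s. g s - g t \<ge> (c - \<eta>) * (s - t)) (at_right t)"
    using assms(1) by (auto simp: lower_slope_def)
  with assms(2) show "eventually (\<lambda>s. f s - f t \<ge> (c - \<eta>) * (s - t)) (at_right t)"
    by eventually_elim linarith
qed

lemma lower_slope_weaken: "lower_slope f t c \<Longrightarrow> d \<le> c \<Longrightarrow> lower_slope f t d"
  unfolding lower_slope_def
proof (intro allI impI)
  fix \<eta> :: real assume a: "\<forall>\<eta>>0. eventually (\<lambda>s. f s - f t \<ge> (c - \<eta>) * (s - t)) (at_right t)"
    "d \<le> c" "\<eta> > 0"
  have "eventually (\<lambda>s. s > t) (at_right t)" by (rule eventually_at_right_less)
  moreover have "eventually (\<lambda>s. f s - f t \<ge> (c - \<eta>) * (s - t)) (at_right t)" using a by auto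
  ultimately show "eventually (\<lambda>s. f s - f t \<ge> (d - \<eta>) * (s - t)) (at_right t)"
  proof eventually_elim
    case (elim s)
    have "(d - \<eta>) * (s - t) \<le> (c - \<eta>) * (s - t)" using elim a(2) by (intro mult_right_mono) auto
    with elim show ?case by linarith
  qed
qed

lemma lower_slope_add:
  assumes "lower_slope f t c" "lower_slope g t d"
  shows "lower_slope (\<lambda>s. f s + g s) t (c + d)"
  unfolding lower_slope_def
proof (intro allI impI)
  fix \<eta> :: real assume "\<eta> > 0"
  then have "eventually (\<lambda>s. f s - f t \<ge> (c - \<eta>/2) * (s - t)) (at_right t)"
    "eventually (\<lambda>s. g s - g t \<ge> (d - \<eta>/2) * (s - t)) (at_right t)"
    using assms by (auto simp: lower_slope_def)
  then show "eventually (\<lambda>s. f s + g s - (f t + g t) \<ge> (c + d - \<eta>) * (s - t)) (at_right t)"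
  proof eventually_elim
    case (elim s)
    have "(c - \<eta>/2) * (s - t) + (d - \<eta>/2) * (s - t) = (c + d - \<eta>) * (s - t)"
      by (simp add: field_simps)
    with elim show ?case by linarith
  qed
qed

lemma has_derivative_at_right_quotient:
  assumes "(f has_real_derivative c) (at_right t)" "d < c"
  shows "eventually (\<lambda>s. f s - f t \<ge> d * (s - t)) (at_right t)"
proof -
  have "eventually (\<lambda>s. (f s - f t) / (s - t) > d) (at_right t)"
    using order_tendstoD(1)[OF assms(1)[unfolded has_field_derivative_iff] assms(2)] .
  with eventually_at_right_less show ?thesis
    by eventually_elim (auto simp: pos_less_divide_eq)
qed

lemma has_real_derivative_imp_lower_slope:
  "(f has_real_derivative c) (at_right t) \<Longrightarrow> lower_slope f t c"
  unfolding lower_slope_def by (auto intro: has_derivative_at_right_quotient)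

text \<open>Splits the increment into w(s) (f(s) - f(t)) and (w(s) - w(t)) f(t). Positivity of w
  preserves the inequality in the first part; the second has a true derivative, so f(t) may have
  either sign.\<close>

lemma lower_slope_mult:
  assumes f: "lower_slope f t c" and w: "(w has_real_derivative w') (at_right t)" and "w t > 0"
  shows "lower_slope (\<lambda>s. w s * f s) t (w' * f t + w t * c)"
  unfolding lower_slope_def
proof (intro allI impI)
  fix \<eta> :: real assume \<eta>: "\<eta> > 0"
  \<comment> \<open>Each part may lose \<eta>/2. Here w(t) \<theta> = \<eta>/4, which leaves room
    for replacing w(t) by w(s).\<close>
  define \<theta> where "\<theta> = \<eta> / (4 * w t)"
  have \<theta>: "\<theta> > 0" using \<eta> assms(3) by (simp add: \<theta>_def)
  have "(w \<longlongrightarrow> w t) (at_right t)"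
    using DERIV_continuous[OF w] by (simp add: continuous_within)
  then have lim: "((\<lambda>s. w s * (c - \<theta>)) \<longlongrightarrow> w t * (c - \<theta>)) (at_right t)"
    and pos: "eventually (\<lambda>s. w s > 0) (at_right t)"
    using assms(3) by (auto intro: tendsto_mult order_tendstoD)
  have "w t * (c - \<theta>) > w t * c - \<eta> / 2"
    using \<eta> assms(3) by (simp add: \<theta>_def algebra_simps)
  then have "eventually (\<lambda>s. w s * (c - \<theta>) > w t * c - \<eta> / 2) (at_right t)"
    using order_tendstoD(1)[OF lim] by blast
  moreover have "eventually (\<lambda>s. f s - f t \<ge> (c - \<theta>) * (s - t)) (at_right t)"
    using f \<theta> by (simp add: lower_slope_def)
  moreover have "eventually (\<lambda>s. w s * f t - w t * f t \<ge> (w' * f t - \<eta> / 2) * (s - t)) (at_right t)"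
    using w \<eta> by (intro has_derivative_at_right_quotient[of "\<lambda>s. w s * f t" "w' * f t"])
      (auto intro!: derivative_eq_intros)
  ultimately show "eventually (\<lambda>s. w s * f s - w t * f t \<ge> (w' * f t + w t * c - \<eta>) * (s - t)) (at_right t)"
    using pos eventually_at_right_less
  proof eventually_elim
    case (elim s)
    have "w s * (f s - f t) \<ge> w s * ((c - \<theta>) * (s - t))" using elim by (intro mult_left_mono) auto
    moreover have "w s * (c - \<theta>) * (s - t) \<ge> (w t * c - \<eta> / 2) * (s - t)"
      using elim by (intro mult_right_mono) auto
    moreover have "(w t * c - \<eta> / 2) * (s - t) + (w' * f t - \<eta> / 2) * (s - t)
        = (w' * f t + w t * c - \<eta>) * (s - t)"
      by (simp add: field_simps)
    moreover have "w s * (f s - f t) = w s * f s - w s * f t"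
      "w s * ((c - \<theta>) * (s - t)) = w s * (c - \<theta>) * (s - t)"
      by (simp_all add: algebra_simps)
    ultimately show ?case using elim(3) by linarith
  qed
qed

text \<open>The passage from an integrated inequality to a pointwise one: f grows at least as fast
  as a primitive of the continuous function h.\<close>

lemma lower_slope_integral:
  assumes "\<And>s. s \<in> {t..b} \<Longrightarrow> f s - f t \<ge> integral {t..s} h" "continuous_on {t..b} h" "t < b"
  shows "lower_slope f t (h t)"
proof (rule lower_slope_eventually_mono)
  have "((\<lambda>s. integral {t..s} h) has_real_derivative h t) (at t within {t..b})"
    using integral_has_real_derivative[OF assms(2), of t] assms(3) by simp
  moreover have "at t within {t..b} = at_right t"
    using assms(3) by (simp add: at_within_Icc_at_right)
  ultimately show "lower_slope (\<lambda>s. integral {t..s} h) t (h t)"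
    by (intro has_real_derivative_imp_lower_slope) simp
  show "eventually (\<lambda>s. f s - f t \<ge> integral {t..s} h - integral {t..t} h) (at_right t)"
    using eventually_at_right_real[OF assms(3)] assms(1) by (auto elim!: eventually_mono)
qed

subsection \<open>The damped system of differential inequalities\<close>

text \<open>\<open>m\<close> is the integrating factor of the damping. The source carries an
  absolute value because positivity of \<open>V\<close> is itself a consequence, and \<tau> is any
  time before the end of existence.\<close>

locale damped_system =
  fixes U V b m \<kappa> :: "real \<Rightarrow> real" and p \<tau> :: real
  assumes p: "p > 1" and \<tau>: "\<tau> > 0"
    and U_deriv: "\<And>t. t \<in> {0..\<tau>} \<Longrightarrow> (U has_real_derivative V t) (at t within {0..\<tau>})"
    and V_cont: "continuous_on {0..\<tau>} V"
    and U_0: "U 0 \<ge> 0" and V_0: "V 0 > 0"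
    and m_deriv: "\<And>t. t \<in> {0..\<tau>} \<Longrightarrow> (m has_real_derivative b t * m t) (at t within {0..\<tau>})"
    and m_0: "m 0 = 1" and m_pos: "\<And>t. t \<in> {0..\<tau>} \<Longrightarrow> m t > 0"
    and b_nonneg: "\<And>t. t \<in> {0..\<tau>} \<Longrightarrow> b t \<ge> 0"
    and \<kappa>_cont: "continuous_on {0..\<tau>} \<kappa>" and \<kappa>_nonneg: "\<And>t. t \<in> {0..\<tau>} \<Longrightarrow> \<kappa> t \<ge> 0"
    and V_slope: "\<And>t. t \<in> {0..<\<tau>} \<Longrightarrow> lower_slope V t (U t - b t * V t + \<kappa> t * \<bar>V t\<bar> powr p)"
begin

lemma at_right_if_within:
  assumes "(f has_real_derivative c) (at t within {0..\<tau>})" "t \<in> {0..<\<tau>}"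
  shows "(f has_real_derivative c) (at_right t)"
proof -
  have "(f has_real_derivative c) (at t within {t..\<tau>})"
    using assms by (intro DERIV_subset[OF assms(1)]) auto
  then show ?thesis using assms(2) by (simp add: at_within_Icc_at_right)
qed

lemma m_cont: "continuous_on {0..\<tau>} m"
  by (rule DERIV_continuous_on, erule m_deriv)

lemma U_cont: "continuous_on {0..\<tau>} U"
  by (rule DERIV_continuous_on, erule U_deriv)

lemma U_nonneg_if_V_nonneg:
  assumes "t \<in> {0..\<tau>}" "\<And>s. s \<in> {0..t} \<Longrightarrow> V s \<ge> 0"
  shows "U t \<ge> 0"
proof -
  have "lower_slope U s 0" if "s \<in> {0..<t}" for s
    using that assms
    by (intro lower_slope_weaken[OF has_real_derivative_imp_lower_slope, of _ "V s"]
        at_right_if_within U_deriv) auto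
  then have "U 0 \<le> U t"
    using assms(1) continuous_on_subset[OF U_cont, of "{0..t}"]
    by (intro lower_slope_nonneg_imp_le[of 0 t U]) auto
  then show ?thesis using U_0 by simp
qed

text \<open>Before a first time c with V(c) \<le> 0, V is positive, hence U is nonnegative, hence m
  V has nonnegative slope. So m V at c is at least V(0) > 0, a contradiction.\<close>

lemma V_pos: "t \<in> {0..\<tau>} \<Longrightarrow> V t > 0"
proof (rule ccontr)
  assume t: "t \<in> {0..\<tau>}" "\<not> V t > 0"
  define Z where "Z = {s \<in> {0..\<tau>}. V s \<le> 0}"
  have "closed Z" unfolding Z_def
    by (intro continuous_on_closed_Collect_le V_cont) auto
  moreover have Z: "Z \<noteq> {}" "bdd_below Z" using t by (auto simp: Z_def)
  ultimately have "Inf Z \<in> Z" using closed_contains_Inf by blast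
  define c where "c = Inf Z"
  have c: "c \<in> {0..\<tau>}" "V c \<le> 0" using \<open>Inf Z \<in> Z\<close> by (auto simp: Z_def c_def)
  have less: "V s > 0" if "s \<in> {0..<c}" for s
  proof (rule ccontr)
    assume "\<not> V s > 0"
    then have "s \<in> Z" using that c by (auto simp: Z_def)
    then have "c \<le> s" using cInf_lower Z(2) by (auto simp: c_def)
    then show False using that by auto
  qed
  have "lower_slope (\<lambda>s. m s * V s) s 0" if s: "s \<in> {0..<c}" for s
  proof (rule lower_slope_weaken)
    have s': "s \<in> {0..<\<tau>}" "s \<in> {0..\<tau>}" using s c by auto
    show "lower_slope (\<lambda>s. m s * V s) s (b s * m s * V s + m s * (U s - b s * V s + \<kappa> s * \<bar>V s\<bar> powr p))"
      using s' by (intro lower_slope_mult V_slope at_right_if_within m_deriv m_pos)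
    have "V r \<ge> 0" if "r \<in> {0..s}" for r using less[of r] that s by force
    then have "U s \<ge> 0" using s' U_nonneg_if_V_nonneg by blast
    then have "m s * (U s + \<kappa> s * \<bar>V s\<bar> powr p) \<ge> 0"
      using m_pos[of s] \<kappa>_nonneg[of s] s' by simp
    then show "0 \<le> b s * m s * V s + m s * (U s - b s * V s + \<kappa> s * \<bar>V s\<bar> powr p)"
      by (simp add: algebra_simps)
  qed
  then have "m 0 * V 0 \<le> m c * V c"
    using c by (intro lower_slope_nonneg_imp_le[of 0 c "\<lambda>s. m s * V s"]
        continuous_on_mult continuous_on_subset[OF m_cont] continuous_on_subset[OF V_cont]) auto
  moreover have "m c * V c \<le> 0" using m_pos c by (simp add: mult_nonneg_nonpos less_imp_le)
  ultimately show False using V_0 m_0 by simp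
qed

lemma U_nonneg: "t \<in> {0..\<tau>} \<Longrightarrow> U t \<ge> 0"
  by (rule U_nonneg_if_V_nonneg) (auto intro!: less_imp_le[OF V_pos])

text \<open>exp(-t) times Duhamel's formula for m V with both kernels cosh t and cosh(t - s)
  replaced by half the exponential; hence the factors 1/2.\<close>

definition y where
  "y t = V 0 / 2 + integral {0..t} (\<lambda>s. exp (- s) * (m s * (\<kappa> s * V s powr p))) / 2"

lemma integrand_cont: "continuous_on {0..\<tau>} (\<lambda>s. exp (- s) * (m s * (\<kappa> s * V s powr p)))"
  using V_pos by (intro continuous_intros m_cont \<kappa>_cont V_cont) force

lemma y_deriv:
  assumes "t \<in> {0..\<tau>}"
  shows "(y has_real_derivative exp (- t) * (m t * (\<kappa> t * V t powr p)) / 2) (at t within {0..\<tau>})"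
proof -
  have "((\<lambda>t. integral {0..t} (\<lambda>s. exp (- s) * (m s * (\<kappa> s * V s powr p))) / 2) has_real_derivative
      exp (- t) * (m t * (\<kappa> t * V t powr p)) / 2) (at t within {0..\<tau>})"
    using DERIV_cdivide[OF integral_has_real_derivative[OF integrand_cont assms]] .
  from DERIV_add[OF DERIV_const this] show ?thesis by (simp add: y_def[abs_def])
qed

text \<open>For the undamped linear system, \<open>m V cosh (\<tau> - s) + m U sinh (\<tau> - s)\<close> is conserved.\<close>

lemma V_lower_bound:
  assumes t: "t \<in> {0..\<tau>}"
  shows "m t * V t \<ge> exp t * y t"
proof -
  \<comment> \<open>At s = t this is the difference to be shown nonnegative. \<open>V\<close> has
    only a lower slope, so it occurs once, with the positive weight m cosh(t - s); the remaining
    terms are differentiable.\<close>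
  define f where "f = (\<lambda>s. (m s * cosh (t - s)) * V s + m s * U s * sinh (t - s) - exp t * y s)"
  have "f 0 \<le> f t"
  proof (rule lower_slope_nonneg_imp_le[of 0 t f])
    have "continuous_on {0..\<tau>} y" by (rule DERIV_continuous_on, erule y_deriv)
    then have "continuous_on {0..\<tau>} f"
      unfolding f_def cosh_def sinh_def
      by (intro continuous_intros m_cont U_cont V_cont) auto
    then show "continuous_on {0..t} f" by (rule continuous_on_subset) (use t in auto)
    fix s assume "s \<in> {0..<t}"
    then have s: "s \<in> {0..<\<tau>}" "s \<in> {0..\<tau>}" "s < t" using t by auto
    have d1: "((\<lambda>s. m s * cosh (t - s)) has_real_derivative
        b s * m s * cosh (t - s) - m s * sinh (t - s)) (at_right s)"
      by (rule derivative_eq_intros at_right_if_within[OF m_deriv] s | simp)+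
    have d2: "((\<lambda>s. m s * U s * sinh (t - s) - exp t * y s) has_real_derivative
        ((b s * m s * U s + m s * V s) * sinh (t - s) - m s * U s * cosh (t - s))
         - exp t * (exp (- s) * (m s * (\<kappa> s * V s powr p)) / 2)) (at_right s)"
    proof -
      have "((\<lambda>s. sinh (t - s)) has_real_derivative - cosh (t - s)) (at_right s)"
        by (rule derivative_eq_intros refl | simp)+
      note D = DERIV_diff[OF DERIV_mult[OF DERIV_mult[OF at_right_if_within[OF m_deriv]
          at_right_if_within[OF U_deriv]] this] DERIV_cmult[OF at_right_if_within[OF y_deriv]]]
      show ?thesis by (rule DERIV_cong[OF D[OF s(2,1) s(2,1) s(2,1)]]) (simp add: algebra_simps)
    qed
    have "lower_slope f s
      (((b s * m s * cosh (t - s) - m s * sinh (t - s)) * V s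
        + m s * cosh (t - s) * (U s - b s * V s + \<kappa> s * \<bar>V s\<bar> powr p))
      + (((b s * m s * U s + m s * V s) * sinh (t - s) - m s * U s * cosh (t - s))
         - exp t * (exp (- s) * (m s * (\<kappa> s * V s powr p)) / 2)))" (is "lower_slope f s ?D")
      unfolding f_def add_diff_eq[symmetric]
      using s m_pos
      by (intro lower_slope_add lower_slope_mult V_slope d1
          has_real_derivative_imp_lower_slope[OF d2]) auto
    moreover have "0 \<le> ?D"
    proof -
      have K: "0 \<le> m s * (\<kappa> s * V s powr p)" using m_pos[of s] \<kappa>_nonneg[of s] s by simp
      \<comment> \<open>The linear terms cancel in pairs. What remains is the source, against cosh
        minus half the exponential, and the term b m U sinh from differentiating m U, both
        nonnegative.\<close>
      have "?D = m s * (\<kappa> s * V s powr p) * (cosh (t - s) - exp (t - s) / 2)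
          + b s * m s * U s * sinh (t - s)"
        using V_pos[OF s(2)] by (simp add: algebra_simps exp_diff exp_minus divide_simps)
      moreover have "cosh (t - s) - exp (t - s) / 2 \<ge> 0"
        by (simp add: cosh_def)
      moreover have "sinh (t - s) \<ge> 0" using s by simp
      ultimately show ?thesis
        using K b_nonneg[of s] m_pos[of s] U_nonneg[of s] s by (simp add: less_imp_le)
    qed
    ultimately show "lower_slope f s 0" by (rule lower_slope_weaken)
  qed (use t in auto)
  moreover have "f 0 \<ge> 0"
  proof -
    have "cosh t - exp t / 2 \<ge> 0" by (simp add: cosh_def)
    then have "V 0 * (cosh t - exp t / 2) \<ge> 0" using V_0 by simp
    moreover have "U 0 * sinh t \<ge> 0" using U_0 t by simp
    ultimately show ?thesis using m_0 by (simp add: f_def y_def algebra_simps)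
  qed
  ultimately show ?thesis by (simp add: f_def)
qed

text \<open>Inserting the lower bound for V into y' gives y' \<ge> k y^p / 2, so y^(1-p) decreases
  at rate at least (p-1) k / 2. As y^(1-p) stays nonnegative, the integral of k is bounded by its
  initial value.\<close>

lemma integral_bound:
  "integral {0..\<tau>} (\<lambda>s. \<kappa> s * exp ((p - 1) * s) * m s powr (1 - p))
     \<le> 2 / (p - 1) * (V 0 / 2) powr (1 - p)"
proof -
  define k where "k = (\<lambda>s. \<kappa> s * exp ((p - 1) * s) * m s powr (1 - p))"
  define F where "F = (\<lambda>t. y t powr (1 - p) + (p - 1) / 2 * integral {0..t} k)"
  have k_cont: "continuous_on {0..\<tau>} k"
    unfolding k_def using m_pos by (intro continuous_intros m_cont \<kappa>_cont) force
  have y_pos: "y t > 0" if t: "t \<in> {0..\<tau>}" for t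
  proof -
    have "integral {0..t} (\<lambda>s. exp (- s) * (m s * (\<kappa> s * V s powr p))) \<ge> 0"
      using t m_pos \<kappa>_nonneg by (intro integral_nonneg integrable_continuous_interval
          continuous_on_subset[OF integrand_cont]) (auto simp: less_imp_le)
    then show ?thesis using V_0 by (simp add: y_def)
  qed
  define y' where "y' = (\<lambda>t. exp (- t) * (m t * (\<kappa> t * V t powr p)) / 2)"
  have "(F has_real_derivative (1 - p) * y t powr (- p) * y' t + (p - 1) / 2 * k t) (at t within {0..\<tau>})"
    if t: "t \<in> {0..\<tau>}" for t
    unfolding F_def y'_def
    by (rule derivative_eq_intros y_deriv integral_has_real_derivative[OF k_cont t] refl t y_pos | simp)+
  moreover have "(1 - p) * y t powr (- p) * y' t + (p - 1) / 2 * k t \<le> 0" if t: "t \<in> {0..\<tau>}" for t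
  proof -
    have "V t \<ge> exp t * y t / m t"
      using V_lower_bound[OF t] m_pos[OF t] by (simp add: field_simps)
    then have "V t powr p \<ge> (exp t * y t / m t) powr p"
      using y_pos[OF t] m_pos[OF t] p by (intro powr_mono2) auto
    also have "(exp t * y t / m t) powr p = exp (p * t) * y t powr p / m t powr p"
      using y_pos[OF t] m_pos[OF t] by (simp add: powr_mult powr_divide exp_powr_real mult.commute)
    finally have "y' t \<ge> exp (- t) * (m t * (\<kappa> t * (exp (p * t) * y t powr p / m t powr p))) / 2"
      using m_pos[OF t] \<kappa>_nonneg[OF t] unfolding y'_def
      by (intro divide_right_mono mult_left_mono) auto
    also have "exp (- t) * (m t * (\<kappa> t * (exp (p * t) * y t powr p / m t powr p))) / 2
        = k t / 2 * y t powr p"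
      using m_pos[OF t]
      by (simp add: k_def powr_diff exp_diff left_diff_distrib exp_minus field_simps)
    finally have "y t powr (- p) * (k t / 2 * y t powr p) \<le> y t powr (- p) * y' t"
      by (intro mult_left_mono) auto
    moreover have "y t powr (- p) * (k t / 2 * y t powr p) = k t / 2"
      using y_pos[OF t] by (simp add: powr_minus field_simps)
    ultimately have "k t / 2 \<le> y t powr (- p) * y' t" by linarith
    then have "(p - 1) * (k t / 2) \<le> (p - 1) * (y t powr (- p) * y' t)"
      using p by (intro mult_left_mono) auto
    then show ?thesis by (simp add: algebra_simps)
  qed
  ultimately have F': "\<exists>D. (F has_real_derivative D) (at t within {0..\<tau>}) \<and> D \<le> 0" if "t \<in> {0..\<tau>}" for t
    using that by blast
  have "lower_slope (\<lambda>t. - F t) t 0" if t: "t \<in> {0..<\<tau>}" for t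
  proof -
    obtain D where D: "(F has_real_derivative D) (at t within {0..\<tau>})" "D \<le> 0"
      using F'[of t] t by auto
    have "((\<lambda>t. - F t) has_real_derivative - D) (at_right t)"
      using at_right_if_within[OF D(1) t] by (rule DERIV_minus)
    with D(2) show ?thesis
      by (intro lower_slope_weaken[OF has_real_derivative_imp_lower_slope]) auto
  qed
  moreover have "continuous_on {0..\<tau>} F"
    unfolding continuous_on_eq_continuous_within using F' DERIV_continuous by fast
  ultimately have "- F 0 \<le> - F \<tau>"
    using \<tau> by (intro lower_slope_nonneg_imp_le[of 0 \<tau> "\<lambda>t. - F t"] continuous_intros) auto
  moreover have "F 0 = (V 0 / 2) powr (1 - p)" by (simp add: F_def y_def)
  moreover have "(p - 1) / 2 * integral {0..\<tau>} k \<le> F \<tau>" by (simp add: F_def)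
  ultimately have "(p - 1) / 2 * integral {0..\<tau>} k \<le> (V 0 / 2) powr (1 - p)"
    by linarith
  then show ?thesis using p by (simp add: k_def field_simps)
qed

end

subsection \<open>Lebesgue integrals\<close>

text \<open>The complement of the essential support is an uncountable union of open sets; the
  Lindelof property makes it countable, which null sets tolerate.\<close>

lemma AE_zero_outside_ess_supp: "AE x in lebesgue. x \<notin> ess_supp f \<longrightarrow> f x = 0"
proof -
  define \<F> where "\<F> = {U. open U \<and> (AE x in lebesgue. x \<in> U \<longrightarrow> f x = 0)}"
  obtain \<G> where \<G>: "\<G> \<subseteq> \<F>" "countable \<G>" "\<Union>\<G> = \<Union>\<F>"
    using Lindelof[of \<F>] by (auto simp: \<F>_def)
  have "AE x in lebesgue. \<forall>U\<in>\<G>. x \<in> U \<longrightarrow> f x = 0"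
    using \<G> by (subst AE_ball_countable) (auto simp: \<F>_def)
  then show ?thesis
    by eventually_elim (use \<G>(3) in \<open>auto simp: ess_supp_def \<F>_def[symmetric]\<close>)
qed

lemma AE_zero_if_ess_supp_subset:
  "ess_supp f \<subseteq> K \<Longrightarrow> AE x in lebesgue. x \<notin> K \<longrightarrow> f x = 0"
  using AE_zero_outside_ess_supp[of f] by eventually_elim auto

lemma L1_loc_set_integrable:
  "f \<in> L1_loc UNIV \<Longrightarrow> compact K \<Longrightarrow> set_integrable lebesgue K f"
  by (auto simp: L1_loc_def)

lemma L1_loc_measurable:
  fixes f :: "'a::euclidean_space \<Rightarrow> real"
  assumes "f \<in> L1_loc UNIV"
  shows "f \<in> borel_measurable lebesgue"
proof (rule borel_measurable_LIMSEQ_real)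
  show "(\<lambda>n. indicator (cball 0 (real n)) x *\<^sub>R f x) \<longlonglongrightarrow> f x" for x
  proof (rule tendsto_eventually)
    obtain N :: nat where "norm x \<le> real N" using real_arch_simple by blast
    then show "eventually (\<lambda>n. indicator (cball 0 (real n)) x *\<^sub>R f x = f x) sequentially"
      by (intro eventually_sequentiallyI[of N]) auto
  qed
  show "(\<lambda>x. indicator (cball 0 (real n)) x *\<^sub>R f x) \<in> borel_measurable lebesgue" for n
    using L1_loc_set_integrable[OF assms compact_cball, of 0 "real n"]
    by (auto simp: set_integrable_def)
qed

text \<open>Measurability of \<open>g\<close> comes from completeness of
  \<open>lebesgue\<close>.\<close>

lemma integrable_lebesgue_cong_AE:
  fixes f g :: "'a::euclidean_space \<Rightarrow> real"
  assumes "integrable lebesgue f" "AE x in lebesgue. f x = g x"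
  shows "integrable lebesgue g" and "(LINT x|lebesgue. g x) = (LINT x|lebesgue. f x)"
proof -
  have m: "f \<in> borel_measurable lebesgue" "g \<in> borel_measurable lebesgue"
    using assms borel_measurable_AE[OF _ assms(2)] by auto
  show "integrable lebesgue g" using integrable_cong_AE[OF m assms(2)] assms(1) by simp
  show "(LINT x|lebesgue. g x) = (LINT x|lebesgue. f x)"
    using integral_cong_AE[OF m assms(2)] by simp
qed

lemma set_integrable_mult_continuous:
  fixes f g :: "'a::euclidean_space \<Rightarrow> real"
  assumes "set_integrable lebesgue K f" "compact K" "continuous_on K g"
  shows "set_integrable lebesgue K (\<lambda>x. f x * g x)"
proof -
  have "(\<lambda>x. g x * f x) absolutely_integrable_on K"
    using assms
    by (intro absolutely_integrable_bounded_measurable_product[OF bilinear_times]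
        continuous_imp_measurable_on_sets_lebesgue compact_imp_bounded compact_continuous_image)
      (auto simp: compact_imp_closed lmeasurable_compact fmeasurableD)
  then show ?thesis by (simp add: mult.commute)
qed

lemma integrable_L1_loc_mult:
  fixes f g :: "'a::euclidean_space \<Rightarrow> real"
  assumes f: "f \<in> L1_loc UNIV" and g: "continuous_on UNIV g" and K: "compact K"
    and z: "AE x in lebesgue. x \<notin> K \<longrightarrow> f x * g x = 0"
  shows "integrable lebesgue (\<lambda>x. f x * g x)"
proof -
have i: "integrable lebesgue (\<lambda>x. indicator K x *\<^sub>R (f x * g x))"
    using set_integrable_mult_continuous[OF L1_loc_set_integrable[OF f K] K continuous_on_subset[OF g]]
    by (simp add: set_integrable_def)
  moreover have "AE x in lebesgue. indicator K x *\<^sub>R (f x * g x) = f x * g x"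
    using z by eventually_elim (auto simp: indicator_def)
  ultimately show ?thesis
    by (rule integrable_lebesgue_cong_AE(1))
qed

text \<open>On a product, \<open>lebesgue\<close> is the completion of the product measure, not the
  product of the completions. Fubini is applied to a Borel representative, and the slices are
  transferred back almost everywhere.\<close>

lemma Fubini_lebesgue:
  fixes f :: "'a::euclidean_space \<times> 'b::euclidean_space \<Rightarrow> real"
  assumes f: "integrable lebesgue f"
  shows "AE s in lebesgue. integrable lebesgue (\<lambda>x. f (s, x))"
    and "integrable lebesgue (\<lambda>s. LINT x|lebesgue. f (s, x))"
proof -
  obtain g where g: "g \<in> borel_measurable lborel" "AE z in lborel. f z = g z"
    using completion_ex_borel_measurable_real[of f lborel] f by auto
  have "integrable lebesgue g"
    using integrable_lebesgue_cong_AE(1)[OF f AE_completion[OF g(2)]] .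
  then have ig: "integrable (lborel \<Otimes>\<^sub>M lborel) g"
    using g(1) by (simp add: lborel_prod integrable_completion)
  have "AE s in lborel. AE x in lborel. f (s, x) = g (s, x)"
    by (rule lborel_pair.AE_pair) (subst lborel_prod, rule g(2))
  then have ae: "AE s in lebesgue. AE x in lebesgue. f (s, x) = g (s, x)"
    by (simp add: AE_completion_iff)
  have "AE s in lebesgue. integrable lborel (\<lambda>x. g (s, x))"
    using lborel_pair.AE_integrable_fst'[OF ig] by (rule AE_completion)
  then have ai: "AE s in lebesgue. integrable lebesgue (\<lambda>x. g (s, x))"
    by eventually_elim (simp add: integrable_completion)
  have eq: "integrable lebesgue (\<lambda>x. f (s, x))"
      "(LINT x|lborel. g (s, x)) = (LINT x|lebesgue. f (s, x))"
    if "AE x in lebesgue. f (s, x) = g (s, x)" "integrable lebesgue (\<lambda>x. g (s, x))" for s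
  proof -
    have gf: "AE x in lebesgue. g (s, x) = f (s, x)" using that(1) by eventually_elim simp
    have "(\<lambda>x. g (s, x)) \<in> borel_measurable lborel" using g(1) by measurable
    then show "integrable lebesgue (\<lambda>x. f (s, x))"
      "(LINT x|lborel. g (s, x)) = (LINT x|lebesgue. f (s, x))"
      using integrable_lebesgue_cong_AE[OF that(2) gf] by (simp_all add: integral_completion)
  qed
  show "AE s in lebesgue. integrable lebesgue (\<lambda>x. f (s, x))"
    using ae ai by eventually_elim (rule eq)
  have a: "AE s in lebesgue. (LINT x|lborel. g (s, x)) = (LINT x|lebesgue. f (s, x))"
    using ae ai by eventually_elim (rule eq)
  have i: "integrable lebesgue (\<lambda>s. LINT x|lborel. g (s, x))"
    using lborel_pair.integrable_fst'[OF ig] by (simp add: integrable_completion)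
  show "integrable lebesgue (\<lambda>s. LINT x|lebesgue. f (s, x))"
    by (rule integrable_lebesgue_cong_AE(1)[OF i a])
qed

text \<open>Integrates a tangent line of a^p, as in a proof of Jensen's inequality. The set S
  confines the constant term of the tangent to where v lives, so that it costs at most K.\<close>

lemma weighted_Hoelder:
  fixes v E :: "'a \<Rightarrow> real"
  assumes p: "p > 1" and S: "AE x in M. x \<notin> S \<longrightarrow> v x = 0" and E: "\<And>x. E x \<ge> 0"
    and i1: "integrable M (\<lambda>x. \<bar>v x\<bar> powr p * E x)" and i2: "integrable M (\<lambda>x. v x * E x)"
    and i3: "integrable M (\<lambda>x. indicator S x * E x)" and K: "(LINT x|M. indicator S x * E x) \<le> K" "K > 0"
  shows "\<bar>LINT x|M. v x * E x\<bar> powr p \<le> K powr (p - 1) * (LINT x|M. \<bar>v x\<bar> powr p * E x)"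
proof (cases "(LINT x|M. v x * E x) = 0")
  case True
  then show ?thesis using E K by simp
next
  case False
  define A where "A = \<bar>LINT x|M. v x * E x\<bar>"
  \<comment> \<open>The point of tangency: a bound for the mean of v with respect to the weight E on
    S.\<close>
  define z where "z = A / K"
  define q where "q = p / (p - 1)"
  have z: "z > 0" "A = z * K" using False K by (auto simp: z_def A_def)
  have q: "q > 1" "1 / p + 1 / q = 1" using p by (auto simp: q_def field_simps)
  have tangent: "p * z powr (p - 1) * a - (p - 1) * z powr p \<le> a powr p" if "a \<ge> 0" for a
  proof -
    have "a * z powr (p - 1) \<le> a powr p / p + (z powr (p - 1)) powr q / q"
      using Youngs_inequality[of p q a "z powr (p - 1)"] p q that by simp
    moreover have "(z powr (p - 1)) powr q = z powr p"
      using p by (simp add: powr_powr q_def)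
    ultimately have "p * (a * z powr (p - 1)) \<le> p * (a powr p / p + z powr p / q)"
      using p by (intro mult_left_mono) auto
    also have "\<dots> = a powr p + (p - 1) * z powr p"
      using p by (simp add: q_def field_simps)
    finally show ?thesis by (simp add: algebra_simps)
  qed
  have iabs: "integrable M (\<lambda>x. \<bar>v x\<bar> * E x)"
    using integrable_abs[OF i2] E by (simp add: abs_mult)
  have "A \<le> (LINT x|M. \<bar>v x\<bar> * E x)"
    using integral_abs_bound[of M "\<lambda>x. v x * E x"] E by (simp add: A_def abs_mult)
  then have "p * z powr (p - 1) * A - (p - 1) * z powr p * K
      \<le> p * z powr (p - 1) * (LINT x|M. \<bar>v x\<bar> * E x) - (p - 1) * z powr p * (LINT x|M. indicator S x * E x)"
    using p K(1) by (intro diff_mono mult_left_mono) auto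
  also have "\<dots> = (LINT x|M. p * z powr (p - 1) * (\<bar>v x\<bar> * E x) - (p - 1) * z powr p * (indicator S x * E x))"
    using iabs i3 by simp
  also have "\<dots> \<le> (LINT x|M. \<bar>v x\<bar> powr p * E x)"
  proof (rule integral_mono_AE)
    show "AE x in M. p * z powr (p - 1) * (\<bar>v x\<bar> * E x) - (p - 1) * z powr p * (indicator S x * E x)
        \<le> \<bar>v x\<bar> powr p * E x"
      using S
    proof eventually_elim
      case (elim x)
      show ?case
      proof (cases "x \<in> S")
        case True
        then show ?thesis
          using mult_right_mono[OF tangent[of "\<bar>v x\<bar>"] E[of x]] by (simp add: algebra_simps)
      qed (use elim in simp)
    qed
  qed (use iabs i1 i3 in auto)
  \<comment> \<open>Since A = z K, the left side p z^(p-1) A - (p-1) z^p K collapses to z^p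
    K.\<close>
  finally have "z powr p * K \<le> (LINT x|M. \<bar>v x\<bar> powr p * E x)"
    using z p by (simp add: powr_diff field_simps)
  then have "K powr (p - 1) * (z powr p * K) \<le> K powr (p - 1) * (LINT x|M. \<bar>v x\<bar> powr p * E x)"
    by (intro mult_left_mono) auto
  moreover have "K powr (p - 1) * (z powr p * K) = A powr p"
    using z K by (simp add: powr_mult powr_diff)
  ultimately show ?thesis by (simp add: A_def)
qed

lemma prod_mono_ennreal:
  fixes f g :: "'a \<Rightarrow> ennreal"
  shows "(\<And>b. b \<in> B \<Longrightarrow> f b \<le> g b) \<Longrightarrow> (\<Prod>b\<in>B. f b) \<le> (\<Prod>b\<in>B. g b)"
  by (induction B rule: infinite_finite_induct) (auto intro!: mult_mono)

subsection \<open>The plane wave on balls\<close>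

lemma nn_integral_exp_half_atMost:
  "(\<integral>\<^sup>+ x. ennreal (if x \<le> r then exp (x / 2 + r / 2) else 0) \<partial>lborel) \<le> ennreal (2 * exp r)"
proof -
  have "(\<integral>\<^sup>+ x. ennreal (if x \<le> r then exp (x / 2 + r / 2) else 0) \<partial>lborel)
      = (\<integral>\<^sup>+ x. ennreal (if - x \<le> r then exp ((0 + - 1 * x) / 2 + r / 2) else 0) \<partial>lborel)"
    by (subst nn_integral_real_affine[where c = "-1" and t = 0]) auto
  also have "\<dots> = (\<integral>\<^sup>+ x. ennreal (exp (- x / 2 + r / 2)) * indicator {- r..} x \<partial>lborel)"
    by (intro nn_integral_cong) (auto simp: indicator_def)
  also have "\<dots> = ennreal (0 - (- 2 * exp (- (- r) / 2 + r / 2)))"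
  proof (rule nn_integral_FTC_atLeast)
    show "((\<lambda>x. - 2 * exp (- x / 2 + r / 2)) \<longlongrightarrow> 0) at_top" by real_asymp
  qed (auto intro!: derivative_eq_intros)
  finally show ?thesis by simp
qed

text \<open>This kernel will dominate a Gaussian, and its primitive c arctan(x/c) is elementary;
  evenness reduces to the half line.\<close>

lemma nn_integral_arctan_deriv:
  assumes "c > 0"
  shows "(\<integral>\<^sup>+ x. ennreal (1 / (1 + (x / c)\<^sup>2)) \<partial>lborel) \<le> ennreal (pi * c)"
proof -
  define f where "f = (\<lambda>x::real. 1 / (1 + (x / c)\<^sup>2))"
  have [measurable]: "f \<in> borel_measurable borel" unfolding f_def by measurable
  have pos: "1 + x\<^sup>2 > 0" for x :: real using zero_le_power2[of x] by linarith
  have half: "(\<integral>\<^sup>+ x. ennreal (f x) * indicator {0..} x \<partial>lborel) = ennreal (c * (pi / 2) - c * arctan (0 / c))"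
  proof (rule nn_integral_FTC_atLeast)
    show "((\<lambda>x. c * arctan (x / c)) \<longlongrightarrow> c * (pi / 2)) at_top"
      using assms by (intro tendsto_intros filterlim_compose[OF tendsto_arctan_at_top]
          filterlim_tendsto_pos_mult_at_top[of "\<lambda>x. 1 / c" "1 / c" _ "\<lambda>x. x", simplified])
        (auto intro: filterlim_ident)
    fix x :: real
    have "((\<lambda>x. c * arctan (x / c)) has_real_derivative c * (inverse (1 + (x / c)\<^sup>2) * (1 / c))) (at x)"
      using assms by (intro DERIV_cmult DERIV_chain2[OF DERIV_arctan] DERIV_cdivide DERIV_ident)
    then show "((\<lambda>x. c * arctan (x / c)) has_real_derivative f x) (at x)"
      by (rule DERIV_cong) (use assms in \<open>simp add: f_def inverse_eq_divide\<close>)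
    show "0 \<le> f x" using pos[of "x / c"] by (simp add: f_def)
  qed simp
  have "(\<integral>\<^sup>+ x. ennreal (f x) \<partial>lborel)
      \<le> (\<integral>\<^sup>+ x. ennreal (f x) * indicator {0..} x + ennreal (f x) * indicator {0..} (- x) \<partial>lborel)"
    by (intro nn_integral_mono) (auto simp: indicator_def)
  also have "\<dots> = (\<integral>\<^sup>+ x. ennreal (f x) * indicator {0..} x \<partial>lborel)
      + (\<integral>\<^sup>+ x. ennreal (f x) * indicator {0..} (- x) \<partial>lborel)"
    by (intro nn_integral_add) auto
  also have "(\<integral>\<^sup>+ x. ennreal (f x) * indicator {0..} (- x) \<partial>lborel)
      = (\<integral>\<^sup>+ x. ennreal (f x) * indicator {0..} x \<partial>lborel)"
    by (subst nn_integral_real_affine[where c = "-1" and t = 0]) (auto simp: f_def)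
  also have "(\<integral>\<^sup>+ x. ennreal (f x) * indicator {0..} x \<partial>lborel)
      + (\<integral>\<^sup>+ x. ennreal (f x) * indicator {0..} x \<partial>lborel) = ennreal (pi * c)"
    unfolding half using assms by (simp flip: ennreal_plus add: field_simps)
  finally show ?thesis by (simp add: f_def)
qed

text \<open>On the ball of radius $r$ one has $x_1 \le r - |x'|^2 / (2 r)$, which splits the integral
  into an exponential one in $x_1$ and Gaussian ones in $x'$.\<close>

lemma exp_on_cball_le_prod:
  fixes x e :: "'a::euclidean_space"
  assumes e: "e \<in> Basis" and r: "r > 0" and x: "norm x \<le> r"
  shows "exp (x \<bullet> e) \<le> exp ((x \<bullet> e) / 2 + r / 2) * (\<Prod>b\<in>Basis - {e}. 1 / (1 + ((x \<bullet> b) / (2 * sqrt r))\<^sup>2))"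
proof -
  define S where "S = (\<Sum>b\<in>Basis - {e}. (x \<bullet> b)\<^sup>2)"
  have "(norm x)\<^sup>2 = (x \<bullet> e)\<^sup>2 + S"
    using e sum.remove[OF finite_Basis e, of "\<lambda>b. (x \<bullet> b)\<^sup>2"]
    by (simp add: S_def power2_norm_eq_inner euclidean_inner[of x x] flip: power2_eq_square)
  moreover have "(norm x)\<^sup>2 \<le> r\<^sup>2" using x by (simp add: power_mono)
  moreover have xe: "\<bar>x \<bullet> e\<bar> \<le> r" using Basis_le_norm[OF e, of x] x by linarith
  moreover have "(r - x \<bullet> e) * (r + x \<bullet> e) \<le> (r - x \<bullet> e) * (2 * r)"
    using xe by (intro mult_left_mono) auto
  ultimately have "S \<le> (r - x \<bullet> e) * (2 * r)" by (simp add: algebra_simps power2_eq_square)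
  \<comment> \<open>Only half of x_1 is traded for transverse decay; the other half keeps the
    x_1-integral convergent at minus infinity.\<close>
  then have "S / (4 * r) \<le> r / 2 - (x \<bullet> e) / 2" using r by (simp add: field_simps)
  then have "exp (x \<bullet> e) \<le> exp ((x \<bullet> e) / 2 + r / 2) * exp (- (S / (4 * r)))"
    by (simp flip: exp_add)
  also have "exp (- (S / (4 * r))) = (\<Prod>b\<in>Basis - {e}. exp (- (((x \<bullet> b) / (2 * sqrt r))\<^sup>2)))"
    using r by (simp add: S_def sum_divide_distrib flip: exp_sum sum_negf)
      (simp add: power_divide power_mult_distrib)
  \<comment> \<open>exp(-z^2) \<le> 1 / (1 + z^2), applied in each transverse direction.\<close>
  also have "\<dots> \<le> (\<Prod>b\<in>Basis - {e}. 1 / (1 + ((x \<bullet> b) / (2 * sqrt r))\<^sup>2))"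
  proof (intro prod_mono conjI)
    fix b
    have "1 + ((x \<bullet> b) / (2 * sqrt r))\<^sup>2 \<le> exp (((x \<bullet> b) / (2 * sqrt r))\<^sup>2)" by (rule exp_ge_add_one_self)
    moreover have "1 + ((x \<bullet> b) / (2 * sqrt r))\<^sup>2 > 0"
      using zero_le_power2[of "(x \<bullet> b) / (2 * sqrt r)"] by linarith
    ultimately show "exp (- (((x \<bullet> b) / (2 * sqrt r))\<^sup>2)) \<le> 1 / (1 + ((x \<bullet> b) / (2 * sqrt r))\<^sup>2)"
      by (simp add: exp_minus field_simps)
  qed simp
  finally show ?thesis by (simp add: mult_left_mono)
qed

text \<open>The majorant is a product of functions of one coordinate. The direction \<open>e\<close>
  contributes 2 exp r, and each of the others \<pi> times the width 2 sqrt r.\<close>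

lemma exp_cball_integral_bound:
  fixes e :: "'a::euclidean_space"
  assumes e: "e \<in> Basis" and r: "r > 0"
  shows "(LINT x|lebesgue. indicator (cball 0 r) x * exp (x \<bullet> e))
      \<le> 2 * (2 * pi) ^ (DIM('a) - 1) * exp r * r powr ((real DIM('a) - 1) / 2)"
proof -
  define f where "f = (\<lambda>b y. if b = e then (if y \<le> r then exp (y / 2 + r / 2) else 0)
      else 1 / (1 + (y / (2 * sqrt r))\<^sup>2))"
  have f_nonneg: "0 \<le> f b y" for b y by (simp add: f_def)
  have [measurable]: "(\<lambda>y. f b y) \<in> borel_measurable borel" for b
    by (cases "b = e") (simp_all add: f_def)
  have le: "indicator (cball 0 r) x * exp (x \<bullet> e) \<le> (\<Prod>b\<in>Basis. f b (x \<bullet> b))" for x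
  proof (cases "x \<in> cball 0 r")
    case True
    then have x: "norm x \<le> r" by simp
    have "x \<bullet> e \<le> r" using Basis_le_norm[OF e, of x] x by linarith
    moreover have "(\<Prod>b\<in>Basis - {e}. f b (x \<bullet> b)) = (\<Prod>b\<in>Basis - {e}. 1 / (1 + ((x \<bullet> b) / (2 * sqrt r))\<^sup>2))"
      by (intro prod.cong) (auto simp: f_def)
    moreover have "f e (x \<bullet> e) * (\<Prod>b\<in>Basis - {e}. f b (x \<bullet> b)) = (\<Prod>b\<in>Basis. f b (x \<bullet> b))"
      using e by (simp add: prod.remove)
    ultimately show ?thesis using exp_on_cball_le_prod[OF e r x] True by (simp add: f_def)
  qed (simp add: prod_nonneg f_nonneg)
  have "(\<integral>\<^sup>+ x. ennreal (indicator (cball 0 r) x * exp (x \<bullet> e)) \<partial>lborel)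
      \<le> (\<integral>\<^sup>+ x. (\<Prod>b\<in>Basis. ennreal (f b (x \<bullet> b))) \<partial>lborel)"
    using le by (intro nn_integral_mono) (simp add: prod_ennreal f_nonneg ennreal_leI)
  also have "\<dots> = (\<Prod>b\<in>(Basis :: 'a set). \<integral>\<^sup>+ y. ennreal (f b y) \<partial>lborel)"
    by (rule nn_integral_lborel_prod) auto
  also have "\<dots> = (\<integral>\<^sup>+ y. ennreal (f e y) \<partial>lborel) * (\<Prod>b\<in>Basis - {e}. \<integral>\<^sup>+ y. ennreal (f b y) \<partial>lborel)"
    using e by (simp add: prod.remove)
  also have "\<dots> \<le> ennreal (2 * exp r) * (\<Prod>b\<in>Basis - {e}. ennreal (pi * (2 * sqrt r)))"
    using r nn_integral_arctan_deriv[of "2 * sqrt r"] nn_integral_exp_half_atMost[of r]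
    by (intro mult_mono prod_mono_ennreal) (auto simp: f_def)
  also have "\<dots> = ennreal (2 * exp r * (pi * (2 * sqrt r)) ^ (DIM('a) - 1))"
  proof -
    have "ennreal c * (\<Prod>b\<in>B. ennreal d) = ennreal (c * d ^ card B)"
      if "c \<ge> 0" "d \<ge> 0" for c d and B :: "'a set"
      using that by (simp add: ennreal_mult ennreal_power)
    from this[of "2 * exp r" "pi * (2 * sqrt r)" "Basis - {e}"] show ?thesis using r e by simp
  qed
  also have "2 * exp r * (pi * (2 * sqrt r)) ^ (DIM('a) - 1)
      = 2 * (2 * pi) ^ (DIM('a) - 1) * exp r * r powr ((real DIM('a) - 1) / 2)" (is "_ = ?B")
    using r by (simp add: power_mult_distrib powr_half_sqrt[symmetric] powr_powr mult_ac
        of_nat_diff flip: powr_realpow)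
  finally have "(\<integral>\<^sup>+ x. ennreal (indicator (cball 0 r) x * exp (x \<bullet> e)) \<partial>lborel) \<le> ennreal ?B" .
  moreover have "?B \<ge> 0" by simp
  ultimately have "(LINT x|lborel. indicator (cball 0 r) x * exp (x \<bullet> e)) \<le> ?B"
    by (intro integral_real_bounded) auto
  moreover have "(\<lambda>x. indicator (cball 0 r) x * exp (x \<bullet> e)) \<in> borel_measurable lborel"
    unfolding measurable_lborel2
    by (intro borel_measurable_times borel_measurable_indicator
        borel_measurable_continuous_onI continuous_intros) auto
  ultimately show ?thesis by (simp only: integral_completion)
qed

subsection \<open>Iterated logarithms\<close>

lemma iter_exp_Suc: "iter_exp (Suc k) = exp (iter_exp k)"
  by (simp add: iter_exp_def)

lemma iter_exp_ge_1: "iter_exp k \<ge> 1"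
  by (induction k) (auto simp: iter_exp_Suc, simp add: iter_exp_def)

lemma iter_ln_Suc: "iter_ln (Suc j) x = ln (iter_ln j x)"
  by (simp add: iter_ln_def)

lemma iter_ln_ge_iter_exp:
  assumes "x \<ge> iter_exp k" "j \<le> k"
  shows "iter_ln j x \<ge> iter_exp (k - j)"
  using assms(2)
proof (induction j)
  case 0
  then show ?case using assms(1) by (simp add: iter_ln_def)
next
  case (Suc j)
  then have *: "iter_ln j x \<ge> exp (iter_exp (k - Suc j))"
    by (simp add: Suc_diff_Suc flip: iter_exp_Suc)
  then have "iter_ln j x > 0" using exp_gt_zero less_le_trans by blast
  then show ?case using * by (simp add: iter_ln_Suc ln_ge_iff)
qed

lemma iter_ln_ge_1: "x \<ge> iter_exp k \<Longrightarrow> j \<le> k \<Longrightarrow> iter_ln j x \<ge> 1"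
  using iter_ln_ge_iter_exp[of k x j] iter_exp_ge_1[of "k - j"] by linarith

lemma iter_ln_pos: "x \<ge> iter_exp k \<Longrightarrow> j \<le> k \<Longrightarrow> iter_ln j x > 0"
  using iter_ln_ge_1[of k x j] by linarith

lemma iter_ln_iter_exp: "iter_ln k (iter_exp k) = 1"
proof -
  have "(ln ^^ k) ((exp ^^ k) x) = x" for x :: real
  proof (induction k)
    case (Suc k)
    have "(ln ^^ Suc k) ((exp ^^ Suc k) x) = (ln ^^ k) (ln (exp ((exp ^^ k) x)))"
      by (simp only: funpow_Suc_right[of k ln] funpow.simps(2)[of k exp] o_apply)
    then show ?case using Suc by simp
  qed simp
  then show ?thesis by (simp add: iter_ln_def iter_exp_def)
qed

lemma iter_ln_mono:
  assumes "iter_exp k \<le> x" "x \<le> y" "j \<le> k"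
  shows "iter_ln j x \<le> iter_ln j y"
  using assms(3)
proof (induction j)
  case 0
  then show ?case using assms(2) by (simp add: iter_ln_def)
next
  case (Suc j)
  then show ?case using iter_ln_pos[of k x j] assms by (simp add: iter_ln_Suc)
qed

text \<open>Further logarithms only decrease a positive number, as ln y \<le> y - 1. It lets all k
  \<ge> 2 be compared with ln ln.\<close>

lemma iter_ln_le_ln_ln:
  assumes "iter_exp k \<le> x" "2 \<le> j" "j \<le> k"
  shows "iter_ln j x \<le> ln (ln x)"
  using assms(2,3)
proof (induction j rule: dec_induct)
  case base
  then show ?case by (simp add: iter_ln_def numeral_2_eq_2)
next
  case (step j)
  then have "ln (iter_ln j x) \<le> iter_ln j x - 1"
    using iter_ln_pos[of k x j] assms(1) by (intro ln_le_minus_one) auto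
  then show ?case using step by (simp add: iter_ln_Suc)
qed

text \<open>Repeated chain rule; the index starts at 0, where \<open>iter_ln 0 x\<close> is x
  itself.\<close>

lemma iter_ln_has_derivative:
  assumes "x \<ge> iter_exp k" "j \<le> k"
  shows "(iter_ln j has_real_derivative 1 / (\<Prod>i<j. iter_ln i x)) (at x)"
  using assms(2)
proof (induction j)
  case 0
  have "iter_ln 0 = (\<lambda>x. x)" by (auto simp: iter_ln_def)
  then show ?case by simp
next
  case (Suc j)
  have "iter_ln (Suc j) = (\<lambda>x. ln (iter_ln j x))" by (auto simp: iter_ln_Suc)
  then show ?case
    using Suc iter_ln_pos[OF assms(1), of j]
    by (auto intro!: derivative_eq_intros simp: field_simps)
qed

section \<open>The integrating factor of the damping\<close>

definition log_weight :: "nat \<Rightarrow> real \<Rightarrow> real" where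
  "log_weight k t = iter_ln k (iter_exp k + t)"

lemma log_weight_ge_1: "t \<ge> 0 \<Longrightarrow> log_weight k t \<ge> 1"
  by (simp add: log_weight_def iter_ln_ge_1[of k])

lemma log_weight_0: "log_weight k 0 = 1"
  by (simp add: log_weight_def iter_ln_iter_exp)

lemma log_weight_mono: "0 \<le> s \<Longrightarrow> s \<le> t \<Longrightarrow> log_weight k s \<le> log_weight k t"
  by (simp add: log_weight_def iter_ln_mono[of k])

lemma log_weight_1: "log_weight (Suc 0) t = ln (exp 1 + t)"
  by (simp add: log_weight_def iter_ln_def iter_exp_def)

lemma log_weight_has_derivative:
  assumes "t \<ge> 0"
  shows "(log_weight k has_real_derivative 1 / (\<Prod>i<k. iter_ln i (iter_exp k + t))) (at t)"
proof -
  have "((\<lambda>t. iter_ln k (iter_exp k + t)) has_real_derivative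
      1 / (\<Prod>i<k. iter_ln i (iter_exp k + t)) * 1) (at t)"
    using assms by (intro DERIV_chain2[OF iter_ln_has_derivative[of k]]) (auto intro!: derivative_eq_intros)
  then show ?thesis by (simp add: log_weight_def[abs_def])
qed

lemma log_weight_cont: "continuous_on {0..} (log_weight k)"
  by (intro continuous_at_imp_continuous_on ballI DERIV_isCont[OF log_weight_has_derivative]) auto

text \<open>Counting the factor \<open>iter_exp k + t\<close> as index 0 and splitting off index k
  turns the damping into \<mu> times the logarithmic derivative of
  \<open>log_weight\<close>.\<close>

lemma damping_altdef:
  "damping \<mu> k t = \<mu> / ((\<Prod>i<k. iter_ln i (iter_exp k + t)) * log_weight k t)"
proof -
  have "(\<Prod>i<Suc k. iter_ln i (iter_exp k + t)) = (iter_exp k + t) * (\<Prod>j = 1..k. iter_ln j (iter_exp k + t))"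
    by (simp add: lessThan_Suc_atMost atMost_atLeast0 prod.atLeast_Suc_atMost iter_ln_def)
  then show ?thesis by (simp add: damping_def log_weight_def)
qed

lemma damping_nonneg: "\<mu> \<ge> 0 \<Longrightarrow> t \<ge> 0 \<Longrightarrow> damping \<mu> k t \<ge> 0"
  unfolding damping_altdef
  by (intro divide_nonneg_nonneg mult_nonneg_nonneg prod_nonneg)
    (auto intro!: less_imp_le[OF iter_ln_pos[of k]] order_trans[OF _ log_weight_ge_1])

lemma log_weight_powr_has_derivative:
  assumes "t \<ge> 0"
  shows "((\<lambda>t. log_weight k t powr \<mu>) has_real_derivative damping \<mu> k t * log_weight k t powr \<mu>) (at t)"
proof -
  have pos: "log_weight k t > 0" using log_weight_ge_1[OF assms, of k] by linarith
  have "((\<lambda>t. log_weight k t powr \<mu>) has_real_derivative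
      \<mu> * log_weight k t powr (\<mu> - 1) * (1 / (\<Prod>i<k. iter_ln i (iter_exp k + t)))) (at t)"
    using pos DERIV_powr[OF log_weight_has_derivative[OF assms] pos DERIV_const[of \<mu>]]
    by (simp add: powr_diff mult_ac)
  moreover have "\<mu> * log_weight k t powr (\<mu> - 1) * (1 / (\<Prod>i<k. iter_ln i (iter_exp k + t)))
      = damping \<mu> k t * log_weight k t powr \<mu>"
    using pos by (simp add: damping_altdef powr_diff)
  ultimately show ?thesis by simp
qed

lemma damping_cont: "continuous_on {0..} (damping \<mu> k)"
proof -
  have "continuous_on {0..} (\<lambda>t. iter_ln i (iter_exp k + t))" if "i \<le> k" for i
  proof (rule continuous_at_imp_continuous_on, rule ballI)
    fix t :: real assume "t \<in> {0..}"
    then show "isCont (\<lambda>t. iter_ln i (iter_exp k + t)) t"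
      using that by (intro isCont_o2[OF _ DERIV_isCont[OF iter_ln_has_derivative[of k]]]) auto
  qed
  moreover have "(\<Prod>i<k. iter_ln i (iter_exp k + t)) * log_weight k t \<noteq> 0" if "t \<ge> 0" for t
  proof -
    have "iter_ln i (iter_exp k + t) \<noteq> 0" if "i < k" for i
      using iter_ln_pos[of k "iter_exp k + t" i] \<open>t \<ge> 0\<close> that by simp
    then show ?thesis using log_weight_ge_1[OF that, of k] by auto
  qed
  ultimately show ?thesis
    unfolding damping_altdef by (intro continuous_intros log_weight_cont) auto
qed

subsection \<open>Lifespan bounds\<close>

text \<open>The integral of m^(1-p)/(R+s), with a standing for \<mu>(p-1).\<close>

definition lifespan_integral :: "nat \<Rightarrow> real \<Rightarrow> real \<Rightarrow> real \<Rightarrow> real" where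
  "lifespan_integral k a R t = integral {0..t} (\<lambda>s. log_weight k s powr (- a) / (R + s))"

lemma lifespan_integrand_cont:
  assumes "R > 0"
  shows "continuous_on {0..t} (\<lambda>s. log_weight k s powr (- a) / (R + s))"
proof -
  have "log_weight k s \<noteq> 0" if "s \<ge> 0" for s using log_weight_ge_1[OF that, of k] by simp
  then show ?thesis
    using assms by (intro continuous_intros continuous_on_subset[OF log_weight_cont]) auto
qed

lemma lifespan_integral_ge:
  assumes "R > 0" "t \<ge> 0" and F: "\<And>s. s \<in> {0..t} \<Longrightarrow> (F has_real_derivative f s) (at s within {0..t})"
    and le: "\<And>s. s \<in> {0..t} \<Longrightarrow> f s \<le> log_weight k s powr (- a) / (R + s)"
  shows "F t - F 0 \<le> lifespan_integral k a R t"
proof -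
  have "(f has_integral (F t - F 0)) {0..t}"
    using assms(2) F by (intro fundamental_theorem_of_calculus) (auto simp: has_real_derivative_iff_has_vector_derivative)
  moreover have "((\<lambda>s. log_weight k s powr (- a) / (R + s)) has_integral lifespan_integral k a R t) {0..t}"
    unfolding lifespan_integral_def
    by (intro integrable_integral integrable_continuous_interval lifespan_integrand_cont assms)
  ultimately show ?thesis using le by (rule has_integral_le)
qed

text \<open>The factor c = min 1 (1/R) satisfies c R \<le> 1 \<le> d and c s \<le> s. It allows
  integrands with shift 1 or e, which have simple primitives.\<close>

lemma inverse_shift_le:
  fixes R s d :: real
  assumes "R > 0" "s \<ge> 0" "d \<ge> 1"
  shows "min 1 (1 / R) / (d + s) \<le> 1 / (R + s)"
proof -
  have "min 1 (1 / R) * R \<le> 1" "min 1 (1 / R) * s \<le> s"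
    using assms by (auto simp: min_def field_simps mult_right_le_one_le)
  then have "min 1 (1 / R) * (R + s) \<le> d + s" using assms by (simp add: algebra_simps)
  then show ?thesis using assms by (simp add: field_simps)
qed

text \<open>The weight decreases in s, so it is replaced by its value at the right end. For k = 1
  and a = 1 the resulting bound stays bounded, and the next lemma takes over.\<close>

lemma lifespan_integral_lower:
  assumes "R > 0" "t \<ge> 0" "a \<ge> 0"
  shows "min 1 (1 / R) * (ln (1 + t) * log_weight k t powr (- a)) \<le> lifespan_integral k a R t"
proof -
  define c where "c = min 1 (1 / R)"
  define D where "D = log_weight k t powr (- a)"
  have "(\<lambda>s. D * (c * ln (1 + s))) t - (\<lambda>s. D * (c * ln (1 + s))) 0 \<le> lifespan_integral k a R t"
  proof (rule lifespan_integral_ge[OF assms(1,2)])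
    fix s assume s: "s \<in> {0..t}"
    show "((\<lambda>s. D * (c * ln (1 + s))) has_real_derivative D * (c / (1 + s))) (at s within {0..t})"
      using s by (auto intro!: derivative_eq_intros)
    have "D \<le> log_weight k s powr (- a)"
      unfolding D_def using s assms log_weight_ge_1[of s k] log_weight_mono[of s t k]
      by (intro powr_mono2') auto
    then have "D * (c / (1 + s)) \<le> log_weight k s powr (- a) * (1 / (R + s))"
      using inverse_shift_le[of R s 1] assms s by (intro mult_mono) (auto simp: c_def D_def)
    then show "D * (c / (1 + s)) \<le> log_weight k s powr (- a) / (R + s)" by simp
  qed
  then show ?thesis by (simp add: c_def D_def mult_ac)
qed

text \<open>Here the integrand has, up to the shift, the exact primitive ln ln(e + s).\<close>

lemma lifespan_integral_lower_critical:
  assumes "R > 0" "t \<ge> 0"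
  shows "min 1 (1 / R) * ln (ln (exp 1 + t)) \<le> lifespan_integral 1 1 R t"
proof -
  define c where "c = min 1 (1 / R)"
  have "(\<lambda>s. c * ln (ln (exp 1 + s))) t - (\<lambda>s. c * ln (ln (exp 1 + s))) 0 \<le> lifespan_integral 1 1 R t"
  proof (rule lifespan_integral_ge[OF assms(1,2)])
    fix s assume s: "s \<in> {0..t}"
    have ln: "ln (exp 1 + s) \<ge> 1" using log_weight_ge_1[of s 1] s by (simp add: log_weight_1)
    have e: "exp 1 + s > 1" using s one_less_exp_iff[of "1 :: real"] unfolding atLeastAtMost_iff by linarith
    show "((\<lambda>s. c * ln (ln (exp 1 + s))) has_real_derivative
        ln (exp 1 + s) powr - 1 * (c / (exp 1 + s))) (at s within {0..t})"
      using s ln e by (auto intro!: derivative_eq_intros simp: powr_minus field_simps)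
    have "ln (exp 1 + s) powr - 1 * (c / (exp 1 + s)) \<le> ln (exp 1 + s) powr - 1 * (1 / (R + s))"
      using inverse_shift_le[of R s "exp 1"] assms s by (intro mult_left_mono) (auto simp: c_def)
    then show "ln (exp 1 + s) powr - 1 * (c / (exp 1 + s)) \<le> log_weight 1 s powr - 1 / (R + s)"
      by (simp add: log_weight_1)
  qed
  then show ?thesis by (simp add: c_def)
qed

lemma filterlim_ln_log_weight:
  assumes "k \<ge> 2 \<or> k = 1 \<and> a < 1" "a \<ge> 0"
  shows "filterlim (\<lambda>t. ln (1 + t) * log_weight k t powr (- a)) at_top at_top"
proof (cases "k \<ge> 2")
  case True
  define E where "E = iter_exp k"
  have E: "E > 0" using iter_exp_ge_1[of k] by (simp add: E_def)
  have "filterlim (\<lambda>t. ln (1 + t) * ln (ln (E + t)) powr (- a)) at_top at_top"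
    using E by real_asymp
  moreover have "eventually (\<lambda>t. ln (1 + t) * ln (ln (E + t)) powr (- a) \<le> ln (1 + t) * log_weight k t powr (- a)) at_top"
    using eventually_ge_at_top[of 0]
  proof eventually_elim
    case (elim t)
    have "log_weight k t \<le> ln (ln (E + t))"
      using True elim by (simp add: log_weight_def iter_ln_le_ln_ln[of k] E_def)
    then show ?case
      using elim log_weight_ge_1[OF elim, of k] assms(2)
      by (intro mult_left_mono powr_mono2') auto
  qed
  ultimately show ?thesis by (rule filterlim_at_top_mono)
next
  case False
  then have "k = 1" "a < 1" using assms by auto
  moreover have "filterlim (\<lambda>t. ln (1 + t) * ln (exp 1 + t) powr (- a)) at_top at_top"
    using \<open>a < 1\<close> by real_asymp
  ultimately show ?thesis by (simp add: log_weight_1)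
qed

text \<open>If T were infinite, the lower bounds for the integral would exceed K. For finite T they
  are evaluated at T itself and solved for T.\<close>

lemma lifespan_bounds:
  fixes T :: ereal
  assumes "R > 0" "a \<ge> 0" "k \<ge> 1" "k = 1 \<Longrightarrow> a \<le> 1" "0 < T"
    and K: "\<And>t. t > 0 \<Longrightarrow> ereal t < T \<Longrightarrow> lifespan_integral k a R t \<le> K"
  defines "c \<equiv> min 1 (1 / R)"
  obtains T' where "T = ereal T'" "T' > 0"
    and "k \<ge> 2 \<Longrightarrow> ln T' * log_weight k T' powr (- a) \<le> K / c"
    and "k = 1 \<Longrightarrow> a < 1 \<Longrightarrow> ln T' \<le> (3 powr a * (K / c)) powr (1 / (1 - a))"
    and "k = 1 \<Longrightarrow> a = 1 \<Longrightarrow> T' \<le> exp (exp (K / c))"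
proof -
  have c: "c > 0" using assms(1) by (simp add: c_def)
  have "T \<noteq> \<infinity>"
  proof
    assume "T = \<infinity>"
    then have K': "lifespan_integral k a R t \<le> K" if "t > 0" for t using K that by simp
    have "\<exists>f :: real \<Rightarrow> real. filterlim f at_top at_top \<and> (\<forall>t>0. c * f t \<le> K)"
    proof (cases "k \<ge> 2 \<or> k = 1 \<and> a < 1")
      case True
      show ?thesis
      proof (intro exI[of _ "\<lambda>t. ln (1 + t) * log_weight k t powr (- a)"] conjI allI impI)
        show "filterlim (\<lambda>t. ln (1 + t) * log_weight k t powr (- a)) at_top at_top"
          by (rule filterlim_ln_log_weight[OF True assms(2)])
        show "c * (ln (1 + t) * log_weight k t powr (- a)) \<le> K" if "t > 0" for t
          using lifespan_integral_lower[OF assms(1) _ assms(2), of t k] K'[OF that] that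
          by (simp add: c_def)
      qed
    next
      case False
      then have "k = 1" "a = 1" using assms by force+
      show ?thesis
      proof (intro exI[of _ "\<lambda>t. ln (ln (exp 1 + t))"] conjI allI impI)
        show "filterlim (\<lambda>t::real. ln (ln (exp 1 + t))) at_top at_top" by real_asymp
        show "c * ln (ln (exp 1 + t)) \<le> K" if "t > 0" for t
          using lifespan_integral_lower_critical[OF assms(1), of t] K'[OF that] that
            \<open>k = 1\<close> \<open>a = 1\<close> by (simp add: c_def)
      qed
    qed
    then obtain f :: "real \<Rightarrow> real" where f: "filterlim f at_top at_top" "\<And>t. t > 0 \<Longrightarrow> c * f t \<le> K" by blast
    have "eventually (\<lambda>t. f t \<ge> K / c + 1) at_top"
      using f(1) by (simp add: filterlim_at_top)
    with eventually_gt_at_top[of 0] have "eventually (\<lambda>t::real. False) at_top"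
    proof eventually_elim
      case (elim t)
      then have "f t \<le> K / c" using f(2)[of t] c by (simp add: field_simps)
      then show False using elim by simp
    qed
    then show False by simp
  qed
  then obtain T' where T': "T = ereal T'" "T' > 0" using assms(5) by (cases T) auto
  \<comment> \<open>The hypothesis covers only times before T'; continuity in the upper limit
    reaches T'.\<close>
  have IT: "lifespan_integral k a R T' \<le> K"
  proof (rule tendsto_upperbound)
    have "continuous_on {0..T'} (lifespan_integral k a R)"
      unfolding lifespan_integral_def
      by (intro indefinite_integral_continuous_1 integrable_continuous_interval lifespan_integrand_cont assms)
    then have "(lifespan_integral k a R \<longlongrightarrow> lifespan_integral k a R T') (at T' within {0..T'})"
      using T' by (auto simp: continuous_on)
    then show "(lifespan_integral k a R \<longlongrightarrow> lifespan_integral k a R T') (at_left T')"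
      using T' by (simp add: at_within_Icc_at_left)
    show "eventually (\<lambda>t. lifespan_integral k a R t \<le> K) (at_left T')"
      using eventually_at_left_real[OF T'(2)] by eventually_elim (use K T' in auto)
  qed simp
  have low: "ln (1 + T') * log_weight k T' powr (- a) \<le> K / c"
    using lifespan_integral_lower[OF assms(1) _ assms(2), of T' k] IT T' c
    by (simp add: c_def[symmetric] field_simps)
  have Kc: "K / c \<ge> 0" using low T' by (intro order_trans[OF _ low]) auto
  show ?thesis
  proof (rule that[OF T'])
    have "ln T' * log_weight k T' powr (- a) \<le> ln (1 + T') * log_weight k T' powr (- a)"
      using T' by (intro mult_right_mono) auto
    then show "ln T' * log_weight k T' powr (- a) \<le> K / c" using low by linarith
  next
    assume k: "k = 1" and a: "a < 1"
    show "ln T' \<le> (3 powr a * (K / c)) powr (1 / (1 - a))"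
    proof (cases "T' \<ge> 1")
      case True
      define l where "l = ln (1 + T')"
      \<comment> \<open>The source of the factor 3: ln(e + T') \<le> 1 + l \<le> 3 l as soon as l
        \<ge> 1/2. For T' < 1 the claim is trivial because ln T' is negative.\<close>
      have l: "l \<ge> 1 / 2"
      proof -
        have "ln 2 \<le> l" using True by (simp add: l_def)
        moreover have "ln (2::real) \<ge> 1 / 2" using ln_le_minus_one[of "1 / 2"] by (simp add: ln_div)
        ultimately show ?thesis by linarith
      qed
      have "exp 1 + T' \<le> exp 1 * (1 + T')" using T' by (simp add: algebra_simps)
      then have "ln (exp 1 + T') \<le> ln (exp 1 * (1 + T'))"
        using T' by (subst ln_le_cancel_iff) (auto intro: add_pos_pos)
      also have "\<dots> = 1 + l" using T' by (simp add: ln_mult l_def)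
      also have "\<dots> \<le> 3 * l" using l by simp
      finally have "(3 * l) powr (- a) \<le> ln (exp 1 + T') powr (- a)"
        using log_weight_ge_1[of T' 1] T' assms(2) by (intro powr_mono2') (auto simp: log_weight_1)
      then have "l * (3 * l) powr (- a) \<le> l * ln (exp 1 + T') powr (- a)"
        using l by (intro mult_left_mono) auto
      also have "\<dots> \<le> K / c" using low by (simp add: l_def k log_weight_1)
      finally have "l * (3 * l) powr (- a) \<le> K / c" .
      moreover have "l * (3 * l) powr (- a) = l powr (1 - a) / 3 powr a"
        using l by (simp add: powr_mult powr_minus powr_diff field_simps)
      ultimately have "l powr (1 - a) / 3 powr a \<le> K / c" by simp
      then have "l powr (1 - a) \<le> 3 powr a * (K / c)"
        by (simp only: pos_divide_le_eq powr_gt_zero) (simp add: mult.commute)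
      then have "(l powr (1 - a)) powr (1 / (1 - a)) \<le> (3 powr a * (K / c)) powr (1 / (1 - a))"
        using a by (intro powr_mono2) auto
      then have "l \<le> (3 powr a * (K / c)) powr (1 / (1 - a))"
        using a l by (simp add: powr_powr)
      moreover have "ln T' \<le> l" using T' by (simp add: l_def)
      ultimately show ?thesis by linarith
    next
      case False
      then have "ln T' \<le> 0" using T' by simp
      then show ?thesis by (rule order_trans) simp
    qed
  next
    assume k: "k = 1" and a: "a = 1"
    have e: "exp 1 + T' > 0" using T' by (intro add_pos_pos) auto
    have ln: "ln (exp 1 + T') > 0" using log_weight_ge_1[of T' 1] T' by (simp add: log_weight_1)
    have "ln (ln (exp 1 + T')) \<le> K / c"
      using lifespan_integral_lower_critical[OF assms(1), of T'] IT T' c k a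
      by (simp add: c_def[symmetric] field_simps)
    then have "exp (ln (exp 1 + T')) \<le> exp (exp (K / c))"
      using ln by (simp add: ln_le_cancel_iff flip: ln_le_cancel_iff[of _ "exp _"])
    then have "exp 1 + T' \<le> exp (exp (K / c))" using e by simp
    then show "T' \<le> exp (exp (K / c))" using exp_gt_zero[of 1] by linarith
  qed
qed

subsection \<open>Functionals of a weak solution\<close>

lemma integrable_vec_componentwise:
  fixes F :: "'a \<Rightarrow> real ^ 'n"
  assumes "\<And>i. integrable M (\<lambda>x. F x $ i)"
  shows "integrable M F"
proof -
  have "integrable M (\<lambda>x. \<Sum>i\<in>UNIV. F x $ i *\<^sub>R axis i (1 :: real))"
    by (intro Bochner_Integration.integrable_sum integrable_scaleR_left assms)
  moreover have "(\<Sum>i\<in>UNIV. F x $ i *\<^sub>R axis i 1) = F x" for x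
    by (simp add: vec_eq_iff axis_def if_distrib sum.delta cong: if_cong)
  ultimately show ?thesis by simp
qed

lemma integral_vec_component:
  fixes F :: "'a \<Rightarrow> real ^ 'n"
  assumes "integrable M F"
  shows "(LINT x|M. F x) $ i = (LINT x|M. F x $ i)"
  using integral_bounded_linear[OF bounded_linear_vec_nth assms] by simp

lemma L1_loc_component:
  fixes g :: "real ^ 'n \<Rightarrow> real ^ 'n"
  assumes "g \<in> L1_loc UNIV"
  shows "(\<lambda>x. g x $ i) \<in> L1_loc UNIV"
  using assms absolutely_integrable_linear[OF _ bounded_linear_vec_nth]
  by (auto simp: L1_loc_def o_def)

lemma plane_wave_pos: "plane_wave i x > 0"
  by (simp add: plane_wave_def)

lemma plane_wave_cont: "continuous_on S (plane_wave i)"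
  using smooth_alg_continuous[OF smooth_alg_plane_wave] continuous_on_subset by blast

lemma plane_wave_measurable: "plane_wave i \<in> borel_measurable lebesgue"
  by (rule measurable_completion) (simp add: borel_measurable_continuous_onI plane_wave_cont)

lemma integrable_plane_wave:
  assumes "f \<in> L1_loc UNIV" "AE x in lebesgue. x \<notin> cball 0 r \<longrightarrow> f x = 0"
  shows "integrable lebesgue (\<lambda>x. f x * plane_wave i x)"
  using assms(2) by (intro integrable_L1_loc_mult[OF assms(1) plane_wave_cont, of "cball 0 r"]) auto

lemma integral_cut_wave:
  assumes f: "f \<in> borel_measurable lebesgue" and z: "AE x in lebesgue. x \<notin> cball 0 r \<longrightarrow> f x = 0"
    and "r \<le> A"
  shows "(LINT x|lebesgue. f x * cut_wave A i x) = (LINT x|lebesgue. f x * plane_wave i x)"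
proof -
  have ae: "AE x in lebesgue. f x * plane_wave i x = f x * cut_wave A i x"
    using z by eventually_elim (use assms(3) in \<open>auto simp: cut_wave_def cutoff_eq_1\<close>)
  have "(\<lambda>x. f x * plane_wave i x) \<in> borel_measurable lebesgue"
    using f plane_wave_measurable by (rule borel_measurable_times)
  then show ?thesis
    using integral_cong_AE[OF _ borel_measurable_AE[OF _ ae] ae] by simp
qed

text \<open>Each partial derivative of the cut wave is itself a test function. Inserting the j-th
  one into the definition of the weak gradient and taking component j integrates by parts; the sum
  over j puts the Laplacian on the wave.\<close>

lemma weak_gradient_cut_wave:
  fixes u :: "real ^ 'n \<Rightarrow> real"
  assumes g: "weak_gradient u g" and u: "u \<in> L1_loc UNIV"
    and z: "AE x in lebesgue. x \<notin> cball 0 r \<longrightarrow> u x = 0" and rA: "r < A"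
  shows "integrable lebesgue (\<lambda>x. g x \<bullet> gradient (cut_wave A i) x)"
    and "(LINT x|lebesgue. g x \<bullet> gradient (cut_wave A i) x) = - (LINT x|lebesgue. u x * plane_wave i x)"
proof -
  define K where "K = cbox (\<Sum>b\<in>Basis. - (A + 1) *\<^sub>R b) (\<Sum>b\<in>Basis. (A + 1) *\<^sub>R b :: real ^ 'n)"
  have K: "compact K" "closed K" by (auto simp: K_def)
  define D where "D = (\<lambda>j. iter_partial [axis j 1] (cut_wave A i))"
  have sD: "smooth_alg (D j)" for j
    unfolding D_def by (intro smooth_alg_iter_partial smooth_alg_cut_wave)
  have zD: "x \<in> K" if "D j x \<noteq> 0" for j x
    using that frechet_derivative_eq_0[OF K(2), of "cut_wave A i" x "axis j 1"] cutoff_support[of A]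
    by (fastforce simp: D_def cut_wave_def K_def)
  have grad_D: "gradient (D j) x $ l = iter_partial [axis l 1, axis j 1] (cut_wave A i) x" for j l x
    by (simp add: gradient_def D_def)
  have tD: "D j \<in> test_functions UNIV" for j
    using sD zD K(1) by (intro test_functionsI[of "D j" K]) auto
  have gL: "(\<lambda>x. g x $ j) \<in> L1_loc UNIV" for j
    using g L1_loc_component by (auto simp: weak_gradient_def)
  have iD: "integrable lebesgue (\<lambda>x. g x $ l * D j x)" for j l
    using zD by (intro integrable_L1_loc_mult[OF gL smooth_alg_continuous[OF sD] K(1)]) auto
  have part: "(LINT x|lebesgue. g x $ j * D j x) = - (if j = i then LINT x|lebesgue. u x * plane_wave i x else 0)" for j
  proof -
    have i1: "integrable lebesgue (\<lambda>x. D j x *\<^sub>R g x)"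
      using iD by (intro integrable_vec_componentwise) (simp add: mult.commute)
    have s2: "smooth_alg (\<lambda>x. iter_partial [axis l 1, axis j 1] (cut_wave A i) x)" for l
      by (intro smooth_alg_iter_partial smooth_alg_cut_wave)
    have i2: "integrable lebesgue (\<lambda>x. u x *\<^sub>R gradient (D j) x)"
    proof (rule integrable_vec_componentwise)
      fix l
      have "integrable lebesgue (\<lambda>x. u x * iter_partial [axis l 1, axis j 1] (cut_wave A i) x)"
        using z by (intro integrable_L1_loc_mult[OF u smooth_alg_continuous[OF s2], of "cball 0 r"]) auto
      then show "integrable lebesgue (\<lambda>x. (u x *\<^sub>R gradient (D j) x) $ l)" by (simp add: grad_D)
    qed
    have "(LINT x|lebesgue. u x *\<^sub>R gradient (D j) x) $ j = - (LINT x|lebesgue. D j x *\<^sub>R g x) $ j"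
      using g tD[of j] by (simp add: weak_gradient_def)
    then have "(LINT x|lebesgue. g x $ j * D j x) = - (LINT x|lebesgue. u x * iter_partial [axis j 1, axis j 1] (cut_wave A i) x)"
      by (simp add: integral_vec_component i1 i2 grad_D mult.commute)
    also have "(LINT x|lebesgue. u x * iter_partial [axis j 1, axis j 1] (cut_wave A i) x)
        = (LINT x|lebesgue. u x * (if j = i then plane_wave i x else 0))"
    proof (rule sym, rule integrable_lebesgue_cong_AE(2))
      show "integrable lebesgue (\<lambda>x. u x * iter_partial [axis j 1, axis j 1] (cut_wave A i) x)"
        using z by (intro integrable_L1_loc_mult[OF u smooth_alg_continuous[OF s2], of "cball 0 r"]) auto
      show "AE x in lebesgue. u x * iter_partial [axis j 1, axis j 1] (cut_wave A i) x
          = u x * (if j = i then plane_wave i x else 0)"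
        using z
      proof eventually_elim
        case (elim x)
        show ?case
        proof (cases "x \<in> cball 0 r")
          case True
          then show ?thesis using rA by (subst cut_wave_second_partial) auto
        qed (use elim in simp)
      qed
    qed
    finally show ?thesis by (simp add: if_distrib cong: if_cong)
  qed
  have eq: "(\<lambda>x. g x \<bullet> gradient (cut_wave A i) x) = (\<lambda>x. \<Sum>j\<in>UNIV. g x $ j * D j x)"
    by (auto simp: inner_vec_def gradient_def D_def)
  show "integrable lebesgue (\<lambda>x. g x \<bullet> gradient (cut_wave A i) x)"
    unfolding eq by (intro Bochner_Integration.integrable_sum iD)
  show "(LINT x|lebesgue. g x \<bullet> gradient (cut_wave A i) x) = - (LINT x|lebesgue. u x * plane_wave i x)"
    unfolding eq by (subst Bochner_Integration.integral_sum) (auto simp: iD part sum_negf)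
qed

lemma time_interval_downward: "s \<in> time_interval T \<Longrightarrow> {0..s} \<subseteq> time_interval T"
  unfolding time_interval_def by auto (meson ereal_less_eq(3) le_less_trans)

lemma time_interval_extend:
  assumes "s \<in> time_interval T" obtains t where "t \<in> time_interval T" "s < t"
  using assms ereal_dense2[of "ereal s" T] by (force simp: time_interval_def)

text \<open>Ensures uniqueness of limits at every time, in particular at 0.\<close>

lemma at_within_time_interval:
  assumes "s \<in> time_interval T"
  shows "at s within time_interval T \<noteq> bot"
proof -
  obtain t where t: "t \<in> time_interval T" "s < t" using time_interval_extend[OF assms] .
  have "{s..t} \<subseteq> {0..t}" using assms by (auto simp: time_interval_def)
  then have "{s..t} \<subseteq> time_interval T" using time_interval_downward[OF t(1)] by blast
  then have "at s within {s..t} \<le> at s within time_interval T" by (rule at_le)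
  moreover have "at s within {s..t} \<noteq> bot"
    using t by (simp add: at_within_Icc_at_right trivial_limit_at_right_real)
  ultimately show ?thesis using bot.extremum_unique by metis
qed

text \<open>The wave is bounded on balls, so one seminorm controls the pairing once all
  \<open>w s\<close> vanish outside a common ball.\<close>

lemma plane_wave_tendsto:
  fixes w :: "real \<Rightarrow> real ^ 'n \<Rightarrow> real"
  assumes lim: "((\<lambda>s. LINT x:cball 0 r|lebesgue. norm (w s x)) \<longlongrightarrow> 0) F"
    and w: "eventually (\<lambda>s. w s \<in> L1_loc UNIV \<and> (AE x in lebesgue. x \<notin> cball 0 r \<longrightarrow> w s x = 0)) F"
  shows "((\<lambda>s. LINT x|lebesgue. w s x * plane_wave i x) \<longlongrightarrow> 0) F"
proof -
  have "bounded (plane_wave i ` cball 0 r)"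
    by (intro compact_imp_bounded compact_continuous_image plane_wave_cont compact_cball)
  then obtain B where B: "\<And>x. x \<in> cball 0 r \<Longrightarrow> norm (plane_wave i x) \<le> B"
    unfolding bounded_iff by blast
  have "((\<lambda>s. B * (LINT x:cball 0 r|lebesgue. norm (w s x))) \<longlongrightarrow> B * 0) F"
    by (intro tendsto_mult tendsto_const lim)
  then have "((\<lambda>s. B * (LINT x:cball 0 r|lebesgue. norm (w s x))) \<longlongrightarrow> 0) F" by simp
  then show ?thesis
  proof (rule Lim_null_comparison[rotated])
    show "eventually (\<lambda>s. norm (LINT x|lebesgue. w s x * plane_wave i x)
        \<le> B * (LINT x:cball 0 r|lebesgue. norm (w s x))) F"
      using w
    proof eventually_elim
      case (elim s)
      then have i1: "integrable lebesgue (\<lambda>x. w s x * plane_wave i x)"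
        by (intro integrable_plane_wave) auto
      have i2: "integrable lebesgue (\<lambda>x. indicator (cball 0 r) x *\<^sub>R norm (w s x))"
        using set_integrable_norm[OF L1_loc_set_integrable[of "w s" "cball 0 r"]] elim
        by (simp add: set_integrable_def)
      have "norm (LINT x|lebesgue. w s x * plane_wave i x) \<le> (LINT x|lebesgue. norm (w s x * plane_wave i x))"
        by (rule integral_norm_bound)
      also have "\<dots> \<le> (LINT x|lebesgue. B * (indicator (cball 0 r) x *\<^sub>R norm (w s x)))"
      proof (rule integral_mono_AE)
        have "AE x in lebesgue. x \<notin> cball 0 r \<longrightarrow> w s x = 0" using elim by simp
        then show "AE x in lebesgue. norm (w s x * plane_wave i x) \<le> B * (indicator (cball 0 r) x *\<^sub>R norm (w s x))"
        proof eventually_elim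
          case (elim x)
          show ?case
          proof (cases "x \<in> cball 0 r")
            case True
            then show ?thesis using mult_left_mono[OF B[OF True], of "\<bar>w s x\<bar>"]
              by (simp add: abs_mult mult.commute)
          qed (use elim in simp)
        qed
      qed (use i1 i2 in auto)
      also have "\<dots> = B * (LINT x:cball 0 r|lebesgue. norm (w s x))"
        by (simp add: set_lebesgue_integral_def)
      finally show ?case .
    qed
  qed
qed

lemma L1_loc_diff: "f \<in> L1_loc S \<Longrightarrow> g \<in> L1_loc S \<Longrightarrow> (\<lambda>x. f x - g x) \<in> L1_loc S"
  by (auto simp: L1_loc_def)

lemma L1_loc_divide:
  fixes f :: "'a::euclidean_space \<Rightarrow> real"
  shows "f \<in> L1_loc S \<Longrightarrow> (\<lambda>x. f x / c) \<in> L1_loc S"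
  by (auto simp: L1_loc_def)

text \<open>Chosen so that \<kappa> is exactly the reciprocal of the Hoelder constant on the ball of
  radius R + s: the first factor inverts the constant of \<open>exp_cball_integral_bound\<close>,
  the second the part exp R of exp(R + s).\<close>

definition wave_const :: "real \<Rightarrow> real \<Rightarrow> nat \<Rightarrow> real" where
  "wave_const p R n = (2 * (2 * pi) ^ (n - 1)) powr (1 - p) * exp (- ((p - 1) * R))"

lemma wave_const_pos: "wave_const p R n > 0"
  by (simp add: wave_const_def)

text \<open>Fixes witnesses \<open>ut\<close> and \<open>gu\<close> of a weak solution and a
  direction \<open>i\<close> of the wave. The primed assumptions keep the shape they have in
  \<open>weak_solution\<close>, so that the locale can be entered by mere assumption.\<close>

locale wave_solution =
  fixes b :: "real \<Rightarrow> real" and p \<epsilon> R :: real and u0 u1 :: "real ^ 'n \<Rightarrow> real" and T :: ereal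
    and u ut :: "real \<Rightarrow> real ^ 'n \<Rightarrow> real" and gu :: "real \<Rightarrow> real ^ 'n \<Rightarrow> real ^ 'n" and i :: 'n
  assumes card: "CARD('n) \<ge> 2" and p_eq: "p = p_Gla CARD('n)" and \<epsilon>: "\<epsilon> > 0" and R: "R > 0"
    and b_cont: "continuous_on {0..} b"
    and u0_supp: "ess_supp u0 \<subseteq> cball 0 R" and u0_nonneg: "AE x in lebesgue. u0 x \<ge> 0"
    and u1_L1: "u1 \<in> L1_loc UNIV" and u1_supp: "ess_supp u1 \<subseteq> cball 0 R"
    and u1_nonneg: "AE x in lebesgue. u1 x \<ge> 0" and u1_nontrivial: "\<not> (AE x in lebesgue. u1 x = 0)"
    and T: "0 < T"
    and gu': "\<forall>t \<in> time_interval T. weak_gradient (u t) (gu t)"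
    and u_cont: "L1_loc_continuous_on (time_interval T) u"
    and u_deriv: "L1_loc_derivative_on (time_interval T) u ut"
    and ut_cont: "L1_loc_continuous_on (time_interval T) ut"
    and ut_powr: "(\<lambda>(s, x). \<bar>ut s x\<bar> powr p) \<in> L1_loc (time_interval T \<times> UNIV)"
    and u_supp': "\<forall>t. 0 < t \<and> ereal t < T \<longrightarrow> ess_supp (u t) \<subseteq> cball 0 (R + t)"
    and u_init: "AE x in lebesgue. u 0 x = \<epsilon> * u0 x"
    and weak': "\<forall>t. 0 < t \<and> ereal t < T \<longrightarrow>
       (\<forall>\<psi> \<in> test_functions ({s. ereal s < T} \<times> UNIV).
       (LINT s:{0..t}|lebesgue. LINT x|lebesgue.
          - ut s x * deriv (\<lambda>r. \<psi> (r, x)) s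
          + gu s x \<bullet> gradient (\<lambda>y. \<psi> (s, y)) x
          + b s * ut s x * \<psi> (s, x))
       + (LINT x|lebesgue. ut t x * \<psi> (t, x))
       = \<epsilon> * (LINT x|lebesgue. u1 x * \<psi> (0, x))
       + (LINT s:{0..t}|lebesgue. LINT x|lebesgue. \<bar>ut s x\<bar> powr p * \<psi> (s, x)))"
begin

lemmas gu = bspec[OF gu']
lemmas u_supp = mp[OF spec[OF u_supp'], OF conjI]
lemmas weak = bspec[OF mp[OF spec[OF weak'], OF conjI]]

abbreviation "I \<equiv> time_interval T"

lemma I_iff: "t \<in> I \<longleftrightarrow> 0 \<le> t \<and> ereal t < T"
  by (simp add: time_interval_def)

lemma p_gt_1: "p > 1"
  using card by (simp add: p_eq p_Gla_def)

text \<open>Criticality of the Glassey exponent; in \<open>N_lower_bound\<close> it makes the power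
  of R + s equal to 1.\<close>

lemma p_exponent: "(real CARD('n) - 1) / 2 * (p - 1) = 1"
  using card by (simp add: p_eq p_Gla_def field_simps)

lemma u_L1: "s \<in> I \<Longrightarrow> u s \<in> L1_loc UNIV"
  and ut_L1: "s \<in> I \<Longrightarrow> ut s \<in> L1_loc UNIV"
  using u_cont ut_cont by (auto simp: L1_loc_continuous_on_def)

lemma u_support: "s \<in> I \<Longrightarrow> AE x in lebesgue. x \<notin> cball 0 (R + s) \<longrightarrow> u s x = 0"
proof (cases "s = 0")
  \<comment> \<open>The support condition speaks of positive times only; at time 0 the support is
    that of the data.\<close>
  case True
  have "AE x in lebesgue. x \<notin> cball 0 R \<longrightarrow> u0 x = 0"
    by (rule AE_zero_if_ess_supp_subset[OF u0_supp])
  with u_init show ?thesis unfolding True by eventually_elim simp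
next
  case False
  assume "s \<in> I"
  with False show ?thesis by (intro AE_zero_if_ess_supp_subset u_supp) (auto simp: I_iff)
qed

lemma u_support_le:
  assumes "s \<in> I" "R + s \<le> r"
  shows "AE x in lebesgue. x \<notin> cball 0 r \<longrightarrow> u s x = 0"
  using u_support[OF assms(1)] by eventually_elim (use assms(2) in auto)

text \<open>Finite speed is prescribed for u only. Off a ball with margin 1/(n+1) the difference
  quotients vanish for times closer than that margin, and so does their limit; the compact sets
  \<open>K n\<close> exhaust the outside of the ball.\<close>

lemma ut_support:
  assumes s: "s \<in> I"
  shows "AE x in lebesgue. x \<notin> cball 0 (R + s) \<longrightarrow> ut s x = 0"
proof -
  define K where "K = (\<lambda>n. cball 0 (real n) - ball (0 :: real ^ 'n) (R + s + 1 / real (Suc n)))"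
  have K: "compact (K n)" for n unfolding K_def by (intro compact_diff) auto
  have "AE x in lebesgue. x \<in> K n \<longrightarrow> ut s x = 0" for n
  proof -
    have lim: "((\<lambda>r. LINT x:K n|lebesgue. norm ((u r x - u s x) / (r - s) - ut s x)) \<longlongrightarrow> 0) (at s within I)"
      using u_deriv s K by (auto simp: L1_loc_derivative_on_def)
    have "eventually (\<lambda>r. (LINT x:K n|lebesgue. norm ((u r x - u s x) / (r - s) - ut s x))
        = (LINT x:K n|lebesgue. norm (ut s x))) (at s within I)"
      unfolding eventually_at
    proof (intro exI[of _ "1 / real (Suc n)"] conjI ballI impI)
      fix r assume r: "r \<in> I" "r \<noteq> s \<and> dist r s < 1 / real (Suc n)"
      have out: "x \<notin> cball 0 (R + r)" "x \<notin> cball 0 (R + s)" if "x \<in> K n" for x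
        using that r by (auto simp: K_def dist_real_def)
      have "(\<lambda>x. indicator (K n) x *\<^sub>R norm ((u r x - u s x) / (r - s) - ut s x)) \<in> borel_measurable lebesgue"
        using set_integrable_norm[OF L1_loc_set_integrable[OF L1_loc_diff[OF
              L1_loc_divide[OF L1_loc_diff[OF u_L1[OF r(1)] u_L1[OF s]], of "r - s"] ut_L1[OF s]] K[of n]]]
        by (intro borel_measurable_integrable) (simp add: set_integrable_def)
      moreover have ae: "AE x in lebesgue. indicator (K n) x *\<^sub>R norm ((u r x - u s x) / (r - s) - ut s x)
          = indicator (K n) x *\<^sub>R norm (ut s x)"
        using u_support[OF r(1)] u_support[OF s]
        by eventually_elim (use out in \<open>auto simp: indicator_def\<close>)
      ultimately show "(LINT x:K n|lebesgue. norm ((u r x - u s x) / (r - s) - ut s x))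
        = (LINT x:K n|lebesgue. norm (ut s x))"
        unfolding set_lebesgue_integral_def
        using borel_measurable_AE[OF _ ae] by (intro integral_cong_AE) auto
    qed simp
    then have "((\<lambda>r. LINT x:K n|lebesgue. norm (ut s x)) \<longlongrightarrow> 0) (at s within I)"
      by (rule Lim_transform_eventually[OF lim])
    then have z: "(LINT x:K n|lebesgue. norm (ut s x)) = 0"
      using at_within_time_interval[OF s] by (simp add: tendsto_const_iff)
    have "integrable lebesgue (\<lambda>x. indicator (K n) x *\<^sub>R norm (ut s x))"
      using set_integrable_norm[OF L1_loc_set_integrable[OF ut_L1[OF s] K]] by (simp add: set_integrable_def)
    then have "AE x in lebesgue. indicator (K n) x *\<^sub>R norm (ut s x) = 0"
      using z by (subst (asm) set_lebesgue_integral_def, subst (asm) integral_nonneg_eq_0_iff_AE) auto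
    then show ?thesis by eventually_elim auto
  qed
  then have "AE x in lebesgue. \<forall>n. x \<in> K n \<longrightarrow> ut s x = 0" by (intro iffD2[OF AE_all_countable] allI)
  then show ?thesis
  proof eventually_elim
    case (elim x)
    show ?case
    proof
      assume "x \<notin> cball 0 (R + s)"
      then have "norm x - (R + s) > 0" by simp
      from reals_Archimedean[OF this] obtain n1 where n1: "1 / real (Suc n1) < norm x - (R + s)"
        by (auto simp: inverse_eq_divide)
      obtain n2 :: nat where n2: "norm x \<le> real n2" using real_arch_simple by blast
      define n where "n = max n1 n2"
      have "1 / real (Suc n) \<le> 1 / real (Suc n1)" by (intro divide_left_mono) (auto simp: n_def)
      then have "x \<in> K n" using n1 n2 by (auto simp: K_def n_def)
      then show "ut s x = 0" using elim by blast
    qed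
  qed
qed

lemma ut_support_le:
  assumes "s \<in> I" "R + s \<le> r"
  shows "AE x in lebesgue. x \<notin> cball 0 r \<longrightarrow> ut s x = 0"
  using ut_support[OF assms(1)] by eventually_elim (use assms(2) in auto)

section \<open>Pairings with the plane wave and the averaged equation\<close>

definition U where "U s = (LINT x|lebesgue. u s x * plane_wave i x)"
definition V where "V s = (LINT x|lebesgue. ut s x * plane_wave i x)"
definition N where "N s = (LINT x|lebesgue. \<bar>ut s x\<bar> powr p * plane_wave i x)"
definition V1 where "V1 = (LINT x|lebesgue. u1 x * plane_wave i x)"

lemma u_integrable: "s \<in> I \<Longrightarrow> integrable lebesgue (\<lambda>x. u s x * plane_wave i x)"
  and ut_integrable: "s \<in> I \<Longrightarrow> integrable lebesgue (\<lambda>x. ut s x * plane_wave i x)"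
  by (auto intro: integrable_plane_wave u_L1 ut_L1 u_support ut_support)

lemma U_has_derivative:
  assumes t: "t \<in> I"
  shows "(U has_real_derivative V t) (at t within I)"
proof -
  define w where "w = (\<lambda>s x. (u s x - u t x) / (s - t) - ut t x)"
  \<comment> \<open>For times within distance 1 of t all supports lie in one ball of radius R + t +
    1.\<close>
  have ev: "eventually (\<lambda>s. s \<in> I \<and> R + s \<le> R + t + 1) (at t within I)"
    unfolding eventually_at by (intro exI[of _ 1]) (auto simp: dist_real_def)
  have "((\<lambda>s. LINT x|lebesgue. w s x * plane_wave i x) \<longlongrightarrow> 0) (at t within I)"
  proof (rule plane_wave_tendsto)
    show "((\<lambda>s. LINT x:cball 0 (R + t + 1)|lebesgue. norm (w s x)) \<longlongrightarrow> 0) (at t within I)"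
      using u_deriv t by (auto simp: L1_loc_derivative_on_def w_def)
    show "eventually (\<lambda>s. w s \<in> L1_loc UNIV \<and> (AE x in lebesgue. x \<notin> cball 0 (R + t + 1) \<longrightarrow> w s x = 0)) (at t within I)"
      using ev
    proof eventually_elim
      case (elim s)
      then have "AE x in lebesgue. x \<notin> cball 0 (R + t + 1) \<longrightarrow> u s x = 0"
        by (intro u_support_le) auto
      moreover have "AE x in lebesgue. x \<notin> cball 0 (R + t + 1) \<longrightarrow> u t x = 0"
        "AE x in lebesgue. x \<notin> cball 0 (R + t + 1) \<longrightarrow> ut t x = 0"
        using t by (intro u_support_le ut_support_le; simp)+
      ultimately have "AE x in lebesgue. x \<notin> cball 0 (R + t + 1) \<longrightarrow> w s x = 0"
        by eventually_elim (simp add: w_def)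
      then show ?case
        using elim t unfolding w_def by (auto intro!: L1_loc_diff L1_loc_divide u_L1 ut_L1)
    qed
  qed
  moreover have "eventually (\<lambda>s. (LINT x|lebesgue. w s x * plane_wave i x) = (U s - U t) / (s - t) - V t) (at t within I)"
    using ev
  proof eventually_elim
    case (elim s)
    have "(\<lambda>x. w s x * plane_wave i x)
        = (\<lambda>x. (u s x * plane_wave i x - u t x * plane_wave i x) / (s - t) - ut t x * plane_wave i x)"
      by (auto simp: w_def left_diff_distrib diff_divide_distrib)
    then show ?case
      using u_integrable[of s] u_integrable[OF t] ut_integrable[OF t] elim
      by (simp add: U_def V_def)
  qed
  ultimately have "((\<lambda>s. (U s - U t) / (s - t) - V t) \<longlongrightarrow> 0) (at t within I)"
    by (rule Lim_transform_eventually)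
  then show ?thesis by (simp add: has_field_derivative_iff LIM_zero_iff)
qed

lemma V_continuous: "continuous_on I V"
  unfolding continuous_on
proof
  fix t assume t: "t \<in> I"
  define w where "w = (\<lambda>s x. ut s x - ut t x)"
  have ev: "eventually (\<lambda>s. s \<in> I \<and> R + s \<le> R + t + 1) (at t within I)"
    unfolding eventually_at by (intro exI[of _ 1]) (auto simp: dist_real_def)
  have "((\<lambda>s. LINT x|lebesgue. w s x * plane_wave i x) \<longlongrightarrow> 0) (at t within I)"
  proof (rule plane_wave_tendsto)
    show "((\<lambda>s. LINT x:cball 0 (R + t + 1)|lebesgue. norm (w s x)) \<longlongrightarrow> 0) (at t within I)"
      using ut_cont t by (auto simp: L1_loc_continuous_on_def w_def)
    show "eventually (\<lambda>s. w s \<in> L1_loc UNIV \<and> (AE x in lebesgue. x \<notin> cball 0 (R + t + 1) \<longrightarrow> w s x = 0)) (at t within I)"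
      using ev
    proof eventually_elim
      case (elim s)
      then have "AE x in lebesgue. x \<notin> cball 0 (R + t + 1) \<longrightarrow> ut s x = 0"
        by (intro ut_support_le) auto
      moreover have "AE x in lebesgue. x \<notin> cball 0 (R + t + 1) \<longrightarrow> ut t x = 0"
        using t by (intro ut_support_le; simp)
      ultimately have "AE x in lebesgue. x \<notin> cball 0 (R + t + 1) \<longrightarrow> w s x = 0"
        by eventually_elim (simp add: w_def)
      then show ?case
        using elim t unfolding w_def by (auto intro!: L1_loc_diff ut_L1)
    qed
  qed
  moreover have "eventually (\<lambda>s. (LINT x|lebesgue. w s x * plane_wave i x) = V s - V t) (at t within I)"
    using ev
  proof eventually_elim
    case (elim s)
    then show ?case
      using ut_integrable[of s] ut_integrable[OF t] by (simp add: V_def w_def left_diff_distrib)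
  qed
  ultimately have "((\<lambda>s. V s - V t) \<longlongrightarrow> 0) (at t within I)"
    by (rule Lim_transform_eventually)
  then show "(V \<longlongrightarrow> V t) (at t within I)" by (simp add: LIM_zero_iff)
qed

lemma U_continuous: "continuous_on I U"
  by (rule DERIV_continuous_on, erule U_has_derivative)

lemma I_subset: "t \<in> I \<Longrightarrow> {0..t} \<subseteq> I"
  by (rule time_interval_downward)

lemma linear_part_continuous: "t \<in> I \<Longrightarrow> continuous_on {0..t} (\<lambda>s. b s * V s - U s)"
  using I_subset
  by (intro continuous_intros continuous_on_subset[OF b_cont] continuous_on_subset[OF V_continuous]
      continuous_on_subset[OF U_continuous]) auto

text \<open>The test function is the cut wave, independent of time in a neighbourhood of [0, t]. Its
  time derivative drops out, and the gradient term becomes -U because the wave is its own Laplacian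
  on the supports.\<close>

lemma averaged_equation_aux:
  assumes t: "0 < t" "t \<in> I"
  shows "(LINT s:{0..t}|lebesgue. b s * V s - U s) + V t = \<epsilon> * V1 + (LINT s:{0..t}|lebesgue. N s)"
proof -
  obtain t1 where t1: "t1 \<in> I" "t < t1" using time_interval_extend[OF t(2)] .
  obtain t2 where t2: "t2 \<in> I" "t1 < t2" using time_interval_extend[OF t1(1)] .
  \<comment> \<open>Strictly larger than R + s for every s in [0, t].\<close>
  define A where "A = R + t + 1"
  define \<psi> where "\<psi> = (\<lambda>z. time_cutoff t1 t2 (fst z) * cut_wave A i (snd z))"
  have test: "\<psi> \<in> test_functions ({s. ereal s < T} \<times> UNIV)"
    unfolding \<psi>_def using t2 by (intro space_time_test_function) (auto simp: I_iff)
  have \<psi>: "\<psi> (s, x) = cut_wave A i x" if "s \<in> {0..t}" for s x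
    using that t1 t2 by (simp add: \<psi>_def time_cutoff_eq_1)
  have d\<psi>: "deriv (\<lambda>r. \<psi> (r, x)) s = 0" if s: "s \<in> {0..t}" for s x
  proof -
    have "time_cutoff t1 t2 r = 1" if "dist r s < min 1 (t1 - t)" for r
      using that s t1 t2 by (intro time_cutoff_eq_1) (auto simp: dist_real_def)
    moreover have "((\<lambda>r. cut_wave A i x) has_real_derivative 0) (at s)" by simp
    ultimately have "((\<lambda>r. \<psi> (r, x)) has_real_derivative 0) (at s)"
      using t1 by (elim has_field_derivative_transform_within[where d = "min 1 (t1 - t)"])
        (simp_all add: \<psi>_def)
    then show ?thesis by (rule DERIV_imp_deriv)
  qed
  have ut_meas: "ut s \<in> borel_measurable lebesgue" if "s \<in> I" for s
    using L1_loc_measurable[OF ut_L1[OF that]] .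
  have lhs: "(LINT x|lebesgue. - ut s x * deriv (\<lambda>r. \<psi> (r, x)) s
          + gu s x \<bullet> gradient (\<lambda>y. \<psi> (s, y)) x + b s * ut s x * \<psi> (s, x)) = b s * V s - U s"
    if s: "s \<in> {0..t}" for s
  proof -
    have sI: "s \<in> I" using I_subset[OF t(2)] s by blast
    have sA: "R + s < A" "R + s \<le> A" using s by (auto simp: A_def)
    note g = weak_gradient_cut_wave[OF gu[OF sI] u_L1[OF sI] u_support[OF sI] sA(1), of i]
    have "integrable lebesgue (\<lambda>x. ut s x * cut_wave A i x)"
      using ut_support[OF sI]
      by (intro integrable_L1_loc_mult[OF ut_L1[OF sI] smooth_alg_continuous[OF smooth_alg_cut_wave], of "cball 0 (R + s)"]) auto
    moreover have "(LINT x|lebesgue. ut s x * cut_wave A i x) = V s"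
      unfolding V_def by (rule integral_cut_wave[OF ut_meas[OF sI] ut_support[OF sI] sA(2)])
    moreover have "(\<lambda>y. \<psi> (s, y)) = cut_wave A i" using \<psi>[OF s] by auto
    ultimately show ?thesis
      using g d\<psi>[OF s] \<psi>[OF s] by (simp add: mult.assoc U_def)
  qed
  have rhs: "(LINT x|lebesgue. \<bar>ut s x\<bar> powr p * \<psi> (s, x)) = N s" if s: "s \<in> {0..t}" for s
  proof -
    have sI: "s \<in> I" using I_subset[OF t(2)] s by blast
    have "AE x in lebesgue. x \<notin> cball 0 (R + s) \<longrightarrow> \<bar>ut s x\<bar> powr p = 0"
      using ut_support[OF sI] by eventually_elim simp
    then show ?thesis
      unfolding N_def \<psi>[OF s] using ut_meas[OF sI] s
      by (intro integral_cut_wave[of _ "R + s"]) (auto simp: A_def)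
  qed
  have "(LINT x|lebesgue. ut t x * \<psi> (t, x)) = V t"
    unfolding V_def using \<psi>[of t] t integral_cut_wave[OF ut_meas[OF t(2)] ut_support[OF t(2)], of A i]
    by (simp add: A_def)
  moreover have "(LINT x|lebesgue. u1 x * \<psi> (0, x)) = V1"
    unfolding V1_def
    using \<psi>[of 0] t integral_cut_wave[OF L1_loc_measurable[OF u1_L1] AE_zero_if_ess_supp_subset[OF u1_supp], of A i]
    by (simp add: A_def)
  moreover have "(LINT s:{0..t}|lebesgue. LINT x|lebesgue. - ut s x * deriv (\<lambda>r. \<psi> (r, x)) s
          + gu s x \<bullet> gradient (\<lambda>y. \<psi> (s, y)) x + b s * ut s x * \<psi> (s, x))
      = (LINT s:{0..t}|lebesgue. b s * V s - U s)"
    by (rule set_lebesgue_integral_cong, simp, intro allI impI, erule lhs)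
  moreover have "(LINT s:{0..t}|lebesgue. LINT x|lebesgue. \<bar>ut s x\<bar> powr p * \<psi> (s, x))
      = (LINT s:{0..t}|lebesgue. N s)"
    by (rule set_lebesgue_integral_cong, simp, intro allI impI, erule rhs)
  ultimately show ?thesis
    using weak[OF t(1) _ test] t(2) by (simp add: I_iff)
qed

lemma I_compact_subset: "t \<in> I \<Longrightarrow> {0..t} \<times> K \<subseteq> I \<times> UNIV"
  using I_subset by blast

text \<open>Joint local integrability of |u_t|^p gives integrable slices only for almost every time;
  at an exceptional time \<open>N\<close> has the default value 0. Hence lower bounds for
  \<open>N\<close> can hold only almost everywhere.\<close>

lemma slice_integrable:
  assumes t: "t \<in> I"
  shows "AE s in lebesgue. s \<in> {0..t} \<longrightarrow> integrable lebesgue (\<lambda>x. \<bar>ut s x\<bar> powr p * plane_wave i x)"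
    and "set_integrable lebesgue {0..t} N"
proof -
  define B where "B = cball (0 :: real ^ 'n) (R + t)"
  \<comment> \<open>Truncation to a compact cylinder; its ball contains the supports at all times up
    to t, so almost everywhere in x nothing is lost.\<close>
  define f where "f = (\<lambda>z. indicator ({0..t} \<times> B) z *\<^sub>R (\<bar>ut (fst z) (snd z)\<bar> powr p * plane_wave i (snd z)))"
  have K: "compact ({0..t} \<times> B)" by (auto simp: B_def intro: compact_Times)
  have "set_integrable lebesgue ({0..t} \<times> B) (\<lambda>z. \<bar>ut (fst z) (snd z)\<bar> powr p)"
    using ut_powr K I_compact_subset[OF t] by (auto simp: L1_loc_def case_prod_unfold)
  moreover have "continuous_on ({0..t} \<times> B) (\<lambda>z. plane_wave i (snd z))"
    by (intro continuous_on_compose2[OF plane_wave_cont[of UNIV]] continuous_intros) auto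
  ultimately have "integrable lebesgue f"
    using set_integrable_mult_continuous[OF _ K] by (auto simp: f_def set_integrable_def)
  note F = Fubini_lebesgue[OF this]
  have f: "f (s, x) = indicator {0..t} s *\<^sub>R (indicator B x * (\<bar>ut s x\<bar> powr p * plane_wave i x))" for s x
    by (auto simp: f_def indicator_def)
  have ae: "AE x in lebesgue. f (s, x) = \<bar>ut s x\<bar> powr p * plane_wave i x" if s: "s \<in> {0..t}" for s
  proof -
    have "AE x in lebesgue. x \<notin> B \<longrightarrow> ut s x = 0"
      unfolding B_def using s I_subset[OF t] by (intro ut_support_le) auto
    then show ?thesis by eventually_elim (use s in \<open>auto simp: f indicator_def\<close>)
  qed
  show "AE s in lebesgue. s \<in> {0..t} \<longrightarrow> integrable lebesgue (\<lambda>x. \<bar>ut s x\<bar> powr p * plane_wave i x)"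
    using F(1)
  proof eventually_elim
    case (elim s)
    show ?case using integrable_lebesgue_cong_AE(1)[OF elim ae] by simp
  qed
  have "(LINT x|lebesgue. f (s, x)) = indicator {0..t} s *\<^sub>R N s" for s
  proof (cases "s \<in> {0..t}")
    case True
    have ae': "AE x in lebesgue. \<bar>ut s x\<bar> powr p * plane_wave i x = f (s, x)"
      using ae[OF True] by eventually_elim simp
    have "s \<in> I" using True I_subset[OF t] by blast
    then have "(\<lambda>x. \<bar>ut s x\<bar> powr p * plane_wave i x) \<in> borel_measurable lebesgue"
      using L1_loc_measurable[OF ut_L1] plane_wave_measurable by measurable
    from integral_cong_AE[OF this borel_measurable_AE[OF this ae'] ae']
    show ?thesis using True by (simp add: N_def)
  qed (simp add: f)
  then show "set_integrable lebesgue {0..t} N"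
    using F(2) by (simp add: set_integrable_def)
qed

definition \<kappa> where "\<kappa> s = wave_const p R CARD('n) * exp (- ((p - 1) * s)) / (R + s)"

text \<open>Hoelder's inequality with weight \<phi> on the ball of radius R + s, whose \<phi>-mass
  is at most \<open>B\<close>.\<close>

lemma N_lower_bound:
  assumes t: "t \<in> I"
  shows "AE s in lebesgue. s \<in> {0..t} \<longrightarrow> \<kappa> s * \<bar>V s\<bar> powr p \<le> N s"
  using slice_integrable(1)[OF t]
proof eventually_elim
  case (elim s)
  show ?case
  proof
    assume s: "s \<in> {0..t}"
    then have sI: "s \<in> I" using I_subset[OF t] by blast
    define c where "c = 2 * (2 * pi) ^ (CARD('n) - 1)"
    define B where "B = c * exp (R + s) * (R + s) powr ((real CARD('n) - 1) / 2)"
    have Rs: "R + s > 0" using R s by simp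
    have c: "c > 0" by (simp add: c_def)
    have B: "B > 0" using Rs c by (simp add: B_def)
    have i3: "integrable lebesgue (\<lambda>x. indicator (cball 0 (R + s)) x * plane_wave i x)"
      using set_integrable_mult_continuous[of "cball 0 (R + s)" "\<lambda>_. 1" "plane_wave i"]
        plane_wave_cont[of "cball 0 (R + s)" i] lmeasurable_cball[of "0 :: real ^ 'n" "R + s"]
      by (simp add: set_integrable_def lmeasurable_iff_integrable)
    have "(LINT x|lebesgue. indicator (cball 0 (R + s)) x * plane_wave i x) \<le> B"
      using exp_cball_integral_bound[of "axis i 1 :: real ^ 'n" "R + s"] Rs
      by (simp add: plane_wave_def B_def c_def axis_in_Basis_iff)
    from weighted_Hoelder[OF p_gt_1 ut_support[OF sI] less_imp_le[OF plane_wave_pos] _ ut_integrable[OF sI] i3 this B]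
    have "\<bar>V s\<bar> powr p \<le> B powr (p - 1) * N s"
      using elim s by (simp add: V_def N_def)
    then have "\<kappa> s * \<bar>V s\<bar> powr p \<le> \<kappa> s * (B powr (p - 1) * N s)"
      using Rs wave_const_pos[of p R "CARD('n)"] by (intro mult_left_mono) (auto simp: \<kappa>_def)
    \<comment> \<open>By \<open>p_exponent\<close>, B^(p-1) is c^(p-1) exp((p-1)(R+s)) (R+s), the
      reciprocal of \<kappa>(s).\<close>
    moreover have "\<kappa> s * B powr (p - 1) = 1"
    proof -
      define X where "X = (p - 1) * (R + s)"
      have "(p - 1) * (real CARD('n) - 1) / 2 = 1" using p_exponent by (simp add: mult.commute)
      then have "B powr (p - 1) = c powr (p - 1) * exp X * (R + s)"
        using c Rs by (simp add: X_def B_def powr_mult powr_powr exp_powr_real mult.commute)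
      moreover have "\<kappa> s = c powr (1 - p) * exp (- X) / (R + s)"
        by (simp add: X_def \<kappa>_def wave_const_def c_def distrib_left flip: exp_add)
      moreover have "c powr (1 - p) * c powr (p - 1) = 1"
        using c by (simp flip: powr_add)
      moreover have "k' * b' = 1" if "b' = x * exp z * y" "k' = x' * exp (- z) / y" "x' * x = 1" "y > 0"
        for b' k' x x' y z :: real
      proof -
        have "k' * b' = (x' * x) * (exp (- z) * exp z) * (y / y)"
          unfolding that(1,2) by (simp only: times_divide_eq_left times_divide_eq_right mult_ac)
        also have "\<dots> = 1" using that(3,4) by (simp flip: exp_add)
        finally show ?thesis .
      qed
      ultimately show ?thesis using Rs by blast
    qed
    ultimately show "\<kappa> s * \<bar>V s\<bar> powr p \<le> N s" by (simp flip: mult.assoc)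
  qed
qed

lemma N_integrable: "t \<in> I \<Longrightarrow> N integrable_on {0..t}"
  using slice_integrable(2) set_lebesgue_integral_eq_integral(1) by blast

text \<open>The weak formulation covers t > 0. Both sides are continuous in t, so the identity
  extends to t = 0 through the closure of the half-open interval.\<close>

lemma averaged_equation:
  assumes \<tau>: "\<tau> \<in> I" and \<tau>0: "\<tau> > 0" and t: "t \<in> {0..\<tau>}"
  shows "integral {0..t} (\<lambda>s. b s * V s - U s) + V t = \<epsilon> * V1 + integral {0..t} N"
proof -
  define D where "D = (\<lambda>t. integral {0..t} (\<lambda>s. b s * V s - U s) + V t - (\<epsilon> * V1 + integral {0..t} N))"
  have cont: "continuous_on {0..\<tau>} D"
    unfolding D_def
    by (intro continuous_intros indefinite_integral_continuous_1 N_integrable[OF \<tau>]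
        integrable_continuous_interval linear_part_continuous[OF \<tau>]
        continuous_on_subset[OF V_continuous I_subset[OF \<tau>]])
  have zero: "D r = 0" if r: "r \<in> {0<..\<tau>}" for r
  proof -
    have rI: "r \<in> I" using r I_subset[OF \<tau>] by auto
    have "set_integrable lebesgue {0..r} (\<lambda>s. b s * V s - U s)"
      by (intro absolutely_integrable_continuous_real linear_part_continuous[OF rI])
    then show ?thesis
      using averaged_equation_aux[OF _ rI] r slice_integrable(2)[OF rI]
      by (simp add: D_def set_lebesgue_integral_eq_integral(2))
  qed
  have "D t = 0"
  proof (cases "t = 0")
    case True
    have "closed {r \<in> {0..\<tau>}. D r = 0}"
      by (intro continuous_closed_preimage_constant cont) simp
    moreover have "{0<..\<tau>} \<subseteq> {r \<in> {0..\<tau>}. D r = 0}" using zero by auto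
    ultimately have "closure {0<..\<tau>} \<subseteq> {r \<in> {0..\<tau>}. D r = 0}" by (rule closure_minimal[rotated])
    then show ?thesis using \<tau>0 True by (simp add: subset_iff)
  qed (use t zero in auto)
  then show ?thesis by (simp add: D_def)
qed

lemma \<kappa>_nonneg: "s \<ge> 0 \<Longrightarrow> \<kappa> s \<ge> 0"
  using R wave_const_pos[of p R "CARD('n)"] by (simp add: \<kappa>_def)

lemma \<kappa>_continuous: "continuous_on {0..t} \<kappa>"
  unfolding \<kappa>_def using R by (intro continuous_intros) auto

lemma \<kappa>V_continuous: "t \<in> I \<Longrightarrow> continuous_on {0..t} (\<lambda>s. \<kappa> s * \<bar>V s\<bar> powr p)"
  using p_gt_1
  by (intro continuous_on_mult \<kappa>_continuous continuous_on_powr' continuous_on_rabs continuous_on_const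
      continuous_on_subset[OF V_continuous I_subset]) auto

text \<open>Replaces the merely integrable \<open>N\<close> by its continuous lower bound, which is
  what makes slopes of \<open>V\<close> accessible.\<close>

lemma V_increment:
  assumes \<tau>: "\<tau> \<in> I" "\<tau> > 0" and t: "0 \<le> t1" "t1 \<le> t2" "t2 \<le> \<tau>"
  shows "integral {t1..t2} (\<lambda>s. U s - b s * V s + \<kappa> s * \<bar>V s\<bar> powr p) \<le> V t2 - V t1"
proof -
  have sub: "{t1..t2} \<subseteq> {0..\<tau>}" "{0..t2} \<subseteq> {0..\<tau>}" using t by auto
  note lin = linear_part_continuous[OF \<tau>(1)] and kap = \<kappa>V_continuous[OF \<tau>(1)]
  have i1: "integral {0..t1} (\<lambda>s. b s * V s - U s) + integral {t1..t2} (\<lambda>s. b s * V s - U s)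
      = integral {0..t2} (\<lambda>s. b s * V s - U s)"
    using t by (intro Henstock_Kurzweil_Integration.integral_combine integrable_continuous_interval
        continuous_on_subset[OF lin sub(2)])
  have i2: "integral {0..t1} N + integral {t1..t2} N = integral {0..t2} N"
    using t by (intro Henstock_Kurzweil_Integration.integral_combine
        integrable_on_subinterval[OF N_integrable[OF \<tau>(1)] sub(2)])
  have sN: "set_integrable lebesgue {t1..t2} N"
    by (rule set_integrable_subset[OF slice_integrable(2)[OF \<tau>(1)] _ sub(1)]) simp
  have sk: "set_integrable lebesgue {t1..t2} (\<lambda>s. \<kappa> s * \<bar>V s\<bar> powr p)"
    by (rule absolutely_integrable_continuous_real[OF continuous_on_subset[OF kap sub(1)]])
  have "(LINT s:{t1..t2}|lebesgue. \<kappa> s * \<bar>V s\<bar> powr p) \<le> (LINT s:{t1..t2}|lebesgue. N s)"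
    unfolding set_lebesgue_integral_def
  proof (rule integral_mono_AE)
    show "AE s in lebesgue. indicator {t1..t2} s *\<^sub>R (\<kappa> s * \<bar>V s\<bar> powr p) \<le> indicator {t1..t2} s *\<^sub>R N s"
      using N_lower_bound[OF \<tau>(1)] by eventually_elim (use sub(1) in \<open>auto simp: indicator_def\<close>)
  qed (use sN sk in \<open>auto simp: set_integrable_def\<close>)
  then have "integral {t1..t2} (\<lambda>s. \<kappa> s * \<bar>V s\<bar> powr p) \<le> integral {t1..t2} N"
    by (simp add: set_lebesgue_integral_eq_integral(2)[OF sN] set_lebesgue_integral_eq_integral(2)[OF sk])
  moreover have "integral {t1..t2} (\<lambda>s. U s - b s * V s + \<kappa> s * \<bar>V s\<bar> powr p)
      = integral {t1..t2} (\<lambda>s. \<kappa> s * \<bar>V s\<bar> powr p - (b s * V s - U s))"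
    by (simp add: algebra_simps)
  moreover have "\<dots> = integral {t1..t2} (\<lambda>s. \<kappa> s * \<bar>V s\<bar> powr p) - integral {t1..t2} (\<lambda>s. b s * V s - U s)"
    by (intro Henstock_Kurzweil_Integration.integral_diff integrable_continuous_interval
        continuous_on_subset[OF lin sub(1)] continuous_on_subset[OF kap sub(1)])
  ultimately show ?thesis
    using averaged_equation[OF \<tau>, of t1] averaged_equation[OF \<tau>, of t2] i1 i2 t by simp
qed

text \<open>The initial velocity enters the definition only through the right side of the weak
  equation; at t = 0 both time integrals vanish and it reappears as the value of
  \<open>V\<close>.\<close>

lemma V_init: "\<tau> \<in> I \<Longrightarrow> \<tau> > 0 \<Longrightarrow> V 0 = \<epsilon> * V1"
  using averaged_equation[of \<tau> 0] by simp

lemma V1_pos: "V1 > 0"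
proof -
  have i: "integrable lebesgue (\<lambda>x. u1 x * plane_wave i x)"
    by (rule integrable_plane_wave[OF u1_L1 AE_zero_if_ess_supp_subset[OF u1_supp]])
  have nn: "AE x in lebesgue. u1 x * plane_wave i x \<ge> 0"
    using u1_nonneg by eventually_elim (simp add: less_imp_le[OF plane_wave_pos])
  have "V1 \<noteq> 0"
  proof
    assume "V1 = 0"
    then have "AE x in lebesgue. u1 x * plane_wave i x = 0"
      using integral_nonneg_eq_0_iff_AE[OF i nn] by (simp add: V1_def)
    then have "AE x in lebesgue. u1 x = 0"
      by eventually_elim (use plane_wave_pos less_irrefl in \<open>metis mult_eq_0_iff\<close>)
    then show False using u1_nontrivial by simp
  qed
  moreover have "V1 \<ge> 0" unfolding V1_def using nn by (rule integral_nonneg_AE)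
  ultimately show ?thesis by simp
qed

lemma U_init: "U 0 \<ge> 0"
  unfolding U_def
proof (rule integral_nonneg_AE)
  show "AE x in lebesgue. 0 \<le> u 0 x * plane_wave i x"
    using u_init u0_nonneg by eventually_elim (use \<epsilon> in \<open>simp add: less_imp_le[OF plane_wave_pos]\<close>)
qed

text \<open>The abstract system is applied on [0, \<tau>]; exp((p-1)s) cancels the decay of
  \<kappa>, so only m^(1-p)/(R+s) is left under the integral.\<close>

lemma lifespan_integral_bound:
  assumes b: "b = damping \<mu> k" and \<mu>: "\<mu> \<ge> 0" and \<tau>: "\<tau> > 0" "ereal \<tau> < T"
  shows "lifespan_integral k (\<mu> * (p - 1)) R \<tau>
    \<le> 2 / (p - 1) * (\<epsilon> * V1 / 2) powr (1 - p) / wave_const p R CARD('n)"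
proof -
  define m where "m = (\<lambda>t. log_weight k t powr \<mu>)"
  have \<tau>I: "\<tau> \<in> I" using \<tau> by (simp add: I_iff)
  interpret damped_system U V b m \<kappa> p \<tau>
  proof
    fix t assume t: "t \<in> {0..\<tau>}"
    show "(U has_real_derivative V t) (at t within {0..\<tau>})"
      using t I_subset[OF \<tau>I] by (intro DERIV_subset[OF U_has_derivative]) auto
    show "(m has_real_derivative b t * m t) (at t within {0..\<tau>})"
      unfolding b m_def using t by (intro DERIV_subset[OF log_weight_powr_has_derivative]) auto
    show "m t > 0" using t log_weight_ge_1[of t k] by (simp add: m_def)
    show "b t \<ge> 0" using t damping_nonneg \<mu> by (simp add: b)
    show "\<kappa> t \<ge> 0" using t \<kappa>_nonneg by simp
  next
    fix t assume t: "t \<in> {0..<\<tau>}"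
    then have sub: "{t..\<tau>} \<subseteq> {0..\<tau>}" by auto
    have "continuous_on {0..\<tau>} (\<lambda>s. \<kappa> s * \<bar>V s\<bar> powr p - (b s * V s - U s))"
      by (intro continuous_intros linear_part_continuous[OF \<tau>I] \<kappa>V_continuous[OF \<tau>I])
    then have "continuous_on {0..\<tau>} (\<lambda>s. U s - b s * V s + \<kappa> s * \<bar>V s\<bar> powr p)"
      by (simp add: algebra_simps)
    then show "lower_slope V t (U t - b t * V t + \<kappa> t * \<bar>V t\<bar> powr p)"
      using t by (intro lower_slope_integral[where b = \<tau> and h = "\<lambda>t. U t - b t * V t + \<kappa> t * \<bar>V t\<bar> powr p"]
          V_increment[OF \<tau>I \<tau>(1)] continuous_on_subset[OF _ sub]) auto
  qed (use p_gt_1 \<tau> U_init V_init[OF \<tau>I \<tau>(1)] V1_pos \<epsilon> \<kappa>_continuous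
      continuous_on_subset[OF V_continuous I_subset[OF \<tau>I]] in \<open>auto simp: m_def log_weight_0\<close>)
  have "integral {0..\<tau>} (\<lambda>s. \<kappa> s * exp ((p - 1) * s) * m s powr (1 - p))
      = integral {0..\<tau>} (\<lambda>s. wave_const p R CARD('n) * (log_weight k s powr - (\<mu> * (p - 1)) / (R + s)))"
  proof (rule Henstock_Kurzweil_Integration.integral_cong)
    fix s assume "s \<in> {0..\<tau>}"
    have "exp (- ((p - 1) * s)) * exp ((p - 1) * s) = 1" by (simp flip: exp_add)
    then have "\<kappa> s * exp ((p - 1) * s) = wave_const p R CARD('n) / (R + s)"
      by (simp add: \<kappa>_def mult.assoc)
    moreover have "m s powr (1 - p) = log_weight k s powr - (\<mu> * (p - 1))"
      by (simp add: m_def powr_powr algebra_simps)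
    ultimately show "\<kappa> s * exp ((p - 1) * s) * m s powr (1 - p)
        = wave_const p R CARD('n) * (log_weight k s powr - (\<mu> * (p - 1)) / (R + s))"
      by simp
  qed
  also have "\<dots> = wave_const p R CARD('n) * lifespan_integral k (\<mu> * (p - 1)) R \<tau>"
    unfolding lifespan_integral_def by (rule Henstock_Kurzweil_Integration.integral_mult_right)
  finally have "wave_const p R CARD('n) * lifespan_integral k (\<mu> * (p - 1)) R \<tau>
      \<le> 2 / (p - 1) * (\<epsilon> * V1 / 2) powr (1 - p)"
    using integral_bound V_init[OF \<tau>I \<tau>(1)] by simp
  then show ?thesis
    using wave_const_pos[of p R "CARD('n)"] by (simp only: pos_le_divide_eq) (simp add: mult.commute)
qed

end

theorem theorem2p4:
  fixes u0 u1 :: "real ^ 'n \<Rightarrow> real" and \<mu> R p :: real and k :: nat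
  assumes "CARD('n) \<ge> 2" and "\<mu> > 0" and "k \<ge> 1"
    and "p = p_Gla CARD('n)"
    and "k = 1 \<Longrightarrow> \<mu> \<le> mu1_star CARD('n)"
    and "u0 \<in> W11_loc" and "u1 \<in> L1_loc UNIV"
    and "AE x in lebesgue. u0 x \<ge> 0" and "AE x in lebesgue. u1 x \<ge> 0"
    and "\<not> (AE x in lebesgue. u0 x = 0)" and "\<not> (AE x in lebesgue. u1 x = 0)"
    and "R > 0" and "ess_supp u0 \<subseteq> cball 0 R" and "ess_supp u1 \<subseteq> cball 0 R"
  shows "\<exists>C > 0. \<forall>\<epsilon> > 0. \<forall>(T\<epsilon> :: ereal) (u :: real \<Rightarrow> real ^ 'n \<Rightarrow> real).
    weak_solution_with_lifespan (damping \<mu> k) p \<epsilon> u0 u1 R T\<epsilon> u \<longrightarrow>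
    (\<exists>T :: real. T\<epsilon> = ereal T \<and>
      (k \<ge> 2 \<longrightarrow>
        ln T * iter_ln k (iter_exp k + T) powr (- (\<mu> * (p - 1))) \<le> C * \<epsilon> powr (- (p - 1))) \<and>
      (k = 1 \<and> \<mu> < (real CARD('n) - 1) / 2 \<longrightarrow>
        ln T \<le> C * \<epsilon> powr (- ((p - 1) / (1 - \<mu> * (p - 1))))) \<and>
      (k = 1 \<and> \<mu> = (real CARD('n) - 1) / 2 \<longrightarrow>
        T \<le> exp (exp (C * \<epsilon> powr (- (p - 1))))))"
proof -
  \<comment> \<open>Any coordinate direction serves; fixing one here makes \<open>A\<close> depend
    on u1 alone and keeps the constants free of \<epsilon>.\<close>
  define A where "A = (LINT x|lebesgue. u1 x * plane_wave (undefined :: 'n) x)"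
  define a where "a = \<mu> * (p - 1)"
  define c where "c = min 1 (1 / R)"
  define C0 where "C0 = 2 / (p - 1) * (A / 2) powr (1 - p) / wave_const p R CARD('n) / c"
  \<comment> \<open>Relevant for k = 1 and a < 1 only; for a = 1 the exponent is 1/0 = 0 and the
    value is harmless.\<close>
  define C1 where "C1 = (3 powr a * C0) powr (1 / (1 - a))"
  have n: "real CARD('n) \<ge> 2" using assms(1) by simp
  have p: "p > 1" "p - 1 = 2 / (real CARD('n) - 1)"
    using n by (auto simp: assms(4) p_Gla_def field_simps)
  have a: "a \<ge> 0" "k = 1 \<Longrightarrow> a \<le> 1"
    "\<mu> < (real CARD('n) - 1) / 2 \<Longrightarrow> a < 1" "\<mu> = (real CARD('n) - 1) / 2 \<Longrightarrow> a = 1"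
  proof -
    show "a \<ge> 0" using assms(2) p(1) by (simp add: a_def)
    show "a \<le> 1" if "k = 1"
      using assms(5)[OF that] p(1) by (simp add: a_def mu1_star_def pos_le_divide_eq flip: assms(4))
    have "a = \<mu> / ((real CARD('n) - 1) / 2)" by (simp add: a_def p(2))
    then show "\<mu> < (real CARD('n) - 1) / 2 \<Longrightarrow> a < 1" "\<mu> = (real CARD('n) - 1) / 2 \<Longrightarrow> a = 1"
      using n assms(2) by (auto simp: pos_divide_less_eq)
  qed
  have c: "c > 0" using assms(12) by (simp add: c_def)
  have C0: "C0 \<ge> 0" using p(1) c wave_const_pos[of p R "CARD('n)"] by (simp add: C0_def)
  have C1: "C1 \<ge> 0" by (simp add: C1_def)
  \<comment> \<open>The sum dominates the constant of each case, and the summand 1 makes it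
    positive.\<close>
  show ?thesis
  proof (rule exI[of _ "C0 + C1 + 1"], intro conjI allI impI)
    show "C0 + C1 + 1 > 0" using C0 C1 by simp
    fix \<epsilon> :: real and T :: ereal and u :: "real \<Rightarrow> real ^ 'n \<Rightarrow> real"
    assume \<epsilon>: "\<epsilon> > 0" and "weak_solution_with_lifespan (damping \<mu> k) p \<epsilon> u0 u1 R T u"
    then have ws: "weak_solution (damping \<mu> k) p \<epsilon> u0 u1 R T u"
      by (simp add: weak_solution_with_lifespan_def)
    then have "\<exists>ut gu. wave_solution (damping \<mu> k) p \<epsilon> R u0 u1 T u ut gu"
      unfolding weak_solution_def
      by (elim exE conjE, intro exI, intro wave_solution.intro)
        (assumption | rule assms \<epsilon> damping_cont)+
    then obtain ut gu where "wave_solution (damping \<mu> k) p \<epsilon> R u0 u1 T u ut gu"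
      by blast
    then interpret wave_solution "damping \<mu> k" p \<epsilon> R u0 u1 T u ut gu "undefined :: 'n" .
    have A: "V1 = A" by (simp only: V1_def A_def)
    have "(\<epsilon> * A / 2) powr (1 - p) = \<epsilon> powr (- (p - 1)) * (A / 2) powr (1 - p)"
      using \<epsilon> V1_pos by (simp add: powr_mult powr_divide A)
    then have K: "2 / (p - 1) * (\<epsilon> * A / 2) powr (1 - p) / wave_const p R CARD('n) / c
        = C0 * \<epsilon> powr (- (p - 1))"
      by (simp add: C0_def)
    show "\<exists>T' :: real. T = ereal T' \<and>
      (k \<ge> 2 \<longrightarrow>
        ln T' * iter_ln k (iter_exp k + T') powr (- (\<mu> * (p - 1))) \<le> (C0 + C1 + 1) * \<epsilon> powr (- (p - 1))) \<and>
      (k = 1 \<and> \<mu> < (real CARD('n) - 1) / 2 \<longrightarrow>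
        ln T' \<le> (C0 + C1 + 1) * \<epsilon> powr (- ((p - 1) / (1 - \<mu> * (p - 1))))) \<and>
      (k = 1 \<and> \<mu> = (real CARD('n) - 1) / 2 \<longrightarrow>
        T' \<le> exp (exp ((C0 + C1 + 1) * \<epsilon> powr (- (p - 1)))))"
    proof (rule lifespan_bounds[OF assms(12) a(1) assms(3) a(2) T])
      show "lifespan_integral k a R t \<le> 2 / (p - 1) * (\<epsilon> * A / 2) powr (1 - p) / wave_const p R CARD('n)"
        if "t > 0" "ereal t < T" for t
        unfolding a_def using lifespan_integral_bound[OF refl _ that] assms(2) by (simp add: A)
      fix T'
      assume T': "T = ereal T'" "T' > 0"
        and 1: "k \<ge> 2 \<Longrightarrow> ln T' * log_weight k T' powr - a
          \<le> 2 / (p - 1) * (\<epsilon> * A / 2) powr (1 - p) / wave_const p R CARD('n) / min 1 (1 / R)"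
        and 2: "k = 1 \<Longrightarrow> a < 1 \<Longrightarrow> ln T' \<le> (3 powr a *
          (2 / (p - 1) * (\<epsilon> * A / 2) powr (1 - p) / wave_const p R CARD('n) / min 1 (1 / R))) powr (1 / (1 - a))"
        and 3: "k = 1 \<Longrightarrow> a = 1 \<Longrightarrow> T'
          \<le> exp (exp (2 / (p - 1) * (\<epsilon> * A / 2) powr (1 - p) / wave_const p R CARD('n) / min 1 (1 / R)))"
      note bounds = 1 2 3
      have le: "C0 * x \<le> (C0 + C1 + 1) * x" "C1 * x \<le> (C0 + C1 + 1) * x" if "x \<ge> 0" for x
        using that C0 C1 by (auto intro: mult_right_mono)
      \<comment> \<open>Taking the power 1/(1-a) of the bound multiplies the exponent of \<epsilon>
        by it, which gives the stated rate.\<close>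
      have "(1 - p) / (1 - a) = - ((p - 1) / (1 - a))"
        by (metis minus_diff_eq minus_divide_left)
      then have "(3 powr a * (C0 * \<epsilon> powr - (p - 1))) powr (1 / (1 - a)) = C1 * \<epsilon> powr - ((p - 1) / (1 - a))"
        using C0 by (simp add: C1_def powr_mult powr_powr mult.assoc)
      note b = bounds[folded c_def, unfolded K this]
      show ?thesis
        using T'(1) b a(3,4) le[of "\<epsilon> powr - (p - 1)"] le[of "\<epsilon> powr - ((p - 1) / (1 - a))"]
        unfolding a_def[symmetric] log_weight_def[symmetric]
        by (intro exI[of _ T'] conjI impI) (auto intro: order_trans)
    qed
  qed
qed

end
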